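(* The structure $(\mathbb{R},+,\cdot,0,1,e^x)$ (the real field expanded by the exponential function) is weakly $F$-selfparameterizable but not $\mathbb{R}$-computable.
   Context: BSS machines: $\mathbb{R}^\infty$ denotes the set of finite sequences of reals and $\mathbb{R}_\infty=\bigoplus_{i\in\mathbb{Z}}\mathbb{R}$. A machine over $\mathbb{R}$ (Blum–Shub–Smale) is a finite connected directed graph with a unique input node (carrying a linear map $\mathbb{R}^\infty\to\mathbb{R}_\infty$), computation nodes (rational maps $\mathbb{R}_\infty\to\mathbb{R}_\infty$), branch nodes (a polynomial $h$, branching on $h\ge0$ versus $h<0$), shift nodes (left/right shift of the bi-infinite sequence), and output nodes (linear maps $\mathbb{R}_\infty\to\mathbb{R}^\infty$); finitely many real constants may be used. A set is $\mathbb{R}$-computable if its characteristic function is computed by such a machine; a structure is $\mathbb{R}$-computable if its atomic diagram (universe, relations, graphs of functions) is $\mathbb{R}$-computable. $F$-parameterizability: a structure $\mathcal{M}$ in a finite language (functions treated via their graphs) is $F$-parameterizable via an injection $\xi:\mathcal{M}\to\omega^\omega$ if the image of $\xi$ is analytic in Baire space and for each relation $P$ (of arity $k$) the set $\{(\xi(a_1),\dots,\xi(a_k)):\mathcal{M}\models P(\bar a)\}$ is analytic. $HF(\mathcal{M})$: the hereditarily finite superstructure over $\mathcal{M}$, with universe $\bigcup_n HF_n(M)$ where $HF_0(M)=\emptyset$ and $HF_{n+1}(M)$ is the set of finite subsets of $M\cup HF_n(M)$, in the language with $\in$ and, for each symbol $\sigma$ of $\mathcal{M}$, a symbol $\sigma^*$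 with $HF(\mathcal{M})\models\sigma^*(\{x_0\},\{x_1\},\dots)$ iff $\mathcal{M}\models\sigma(x_0,x_1,\dots)$. Weak $F$-selfparameterizability: an $F$-parameterizable $\mathcal{M}$ (with $F$-parameterization $\xi$) is weakly $F$-selfparameterizable if there are functions $\Xi,p:\mathcal{M}\times\omega\to\omega$, both definable without parameters in $HF(\mathcal{M})$, such that $\Xi(x,m)=\xi(x)(m)$ for all $x\in\mathcal{M}$, $m\in\omega$, and for every $f\in\omega^\omega$ there is $x\in\mathcal{M}$ with $p(x,n)=f(n)$ for all $n\in\omega$.
   Formalization: The universe of HF(M) is taken as M together with the union of the HF_n(M), so elements of M are objects with visible membership; with the union alone, swapping ∅ and {0,1} hereditarily is an automorphism, so no function on M×ω would be definable. *)

theory Defs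
  imports "HOL-Analysis.Analysis" "HOL-Library.Poly_Mapping" "HOL-Library.FSet"
begin

section \<open>Structures and first-order definability\<close>

text \<open>All languages are relational: a function symbol is represented by its graph. The type
  of symbols is the language.\<close>

record ('s, 'a) struct =
  universe :: "'a set"
  arity :: "'s \<Rightarrow> nat"
  interp :: "'s \<Rightarrow> 'a list set"

definition map_struct :: "('a \<Rightarrow> 'b) \<Rightarrow> ('s, 'a) struct \<Rightarrow> ('s, 'b) struct" where
  "map_struct f M = \<lparr>universe = f ` universe M, arity = arity M,
                     interp = (\<lambda>s. map f ` interp M s)\<rparr>"

datatype 's fm =
    Eq nat nat
  | Rel 's "nat list"
  | Neg "'s fm"
  | Conj "'s fm" "'s fm"
  | Ex nat "'s fm"

primrec fv :: "'s fm \<Rightarrow> nat set" where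
  "fv (Eq i j) = {i, j}"
| "fv (Rel s is) = set is"
| "fv (Neg \<phi>) = fv \<phi>"
| "fv (Conj \<phi> \<psi>) = fv \<phi> \<union> fv \<psi>"
| "fv (Ex i \<phi>) = fv \<phi> - {i}"

primrec sat :: "('s, 'a) struct \<Rightarrow> (nat \<Rightarrow> 'a) \<Rightarrow> 's fm \<Rightarrow> bool" where
  "sat M v (Eq i j) \<longleftrightarrow> v i = v j"
| "sat M v (Rel s is) \<longleftrightarrow> map v is \<in> interp M s"
| "sat M v (Neg \<phi>) \<longleftrightarrow> \<not> sat M v \<phi>"
| "sat M v (Conj \<phi> \<psi>) \<longleftrightarrow> sat M v \<phi> \<and> sat M v \<psi>"
| "sat M v (Ex i \<phi>) \<longleftrightarrow> (\<exists>a\<in>universe M. sat M (v(i := a)) \<phi>)"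

text \<open>Definability without parameters. The values of the assignment at indices outside
  \<open>{..<k}\<close> are irrelevant by the condition on the free variables.\<close>

definition definable :: "('s, 'a) struct \<Rightarrow> nat \<Rightarrow> 'a list set \<Rightarrow> bool" where
  "definable M k R \<longleftrightarrow> (\<exists>\<phi>. fv \<phi> \<subseteq> {..<k} \<and>
     R = {as. length as = k \<and> set as \<subseteq> universe M \<and> sat M (\<lambda>i. as ! i) \<phi>})"


section \<open>The hereditarily finite superstructure\<close>

datatype 'a hf = Urel 'a | HSet "'a hf fset"

primrec HF_level :: "'a set \<Rightarrow> nat \<Rightarrow> 'a hf set" where
  "HF_level A 0 = {}"
| "HF_level A (Suc n) = {HSet B | B. fset B \<subseteq> Urel ` A \<union> HF_level A n}"

datatype 's hf_sym = Mem | Star 's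

text \<open>The elements of the base structure are present as urelements, so that membership of an
  urelement in a set is visible to formulas. If quantifiers and membership were restricted to
  \<open>\<Union>n. HF_level A n\<close>, the empty set and any set of two urelements would be exchanged by an
  automorphism, and no natural number would be definable.\<close>

definition HF :: "('s, 'a) struct \<Rightarrow> ('s hf_sym, 'a hf) struct" where
  "HF M = (let U = Urel ` universe M \<union> (\<Union>n. HF_level (universe M) n) in
     \<lparr>universe = U,
      arity = (\<lambda>\<sigma>. case \<sigma> of Mem \<Rightarrow> 2 | Star s \<Rightarrow> arity M s),
      interp = (\<lambda>\<sigma>. case \<sigma> of
          Mem \<Rightarrow> {[a, HSet B] | a B. a \<in> U \<and> HSet B \<in> U \<and> a |\<in>| B}
        | Star s \<Rightarrow> {map (\<lambda>x. HSet {|Urel x|}) xs | xs. xs \<in> interp M s})\<rparr>)"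

text \<open>The natural numbers inside the superstructure are the von Neumann ordinals.\<close>

primrec hf_nat_elts :: "nat \<Rightarrow> 'a hf fset" where
  "hf_nat_elts 0 = {||}"
| "hf_nat_elts (Suc n) = finsert (HSet (hf_nat_elts n)) (hf_nat_elts n)"

definition hf_nat :: "nat \<Rightarrow> 'a hf" where
  "hf_nat n = HSet (hf_nat_elts n)"

definition HF_definable_fun :: "('s, 'a) struct \<Rightarrow> ('a \<Rightarrow> nat \<Rightarrow> nat) \<Rightarrow> bool" where
  "HF_definable_fun M F \<longleftrightarrow>
     definable (HF M) 3 {[Urel x, hf_nat m, hf_nat (F x m)] | x m. x \<in> universe M}"


section \<open>F-parameterizability\<close>

text \<open>The type \<open>nat \<Rightarrow> nat\<close> with its product topology is Baire space.\<close>

definition analytic_in :: "'b topology \<Rightarrow> 'b set \<Rightarrow> bool" where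
  "analytic_in X A \<longleftrightarrow> A = {} \<or>
     (\<exists>f. continuous_map (euclidean :: (nat \<Rightarrow> nat) topology) X f \<and> A = range f)"

definition F_parameterization ::
    "('s::finite, 'a) struct \<Rightarrow> ('a \<Rightarrow> nat \<Rightarrow> nat) \<Rightarrow> bool" where
  "F_parameterization M \<xi> \<longleftrightarrow>
     inj_on \<xi> (universe M) \<and>
     analytic_in euclidean (\<xi> ` universe M) \<and>
     (\<forall>s. analytic_in (product_topology (\<lambda>_. euclidean) {..<arity M s})
            {restrict (\<lambda>i. \<xi> (as ! i)) {..<arity M s} | as. as \<in> interp M s})"

definition weakly_F_selfparameterizable :: "('s::finite, 'a) struct \<Rightarrow> bool" where
  "weakly_F_selfparameterizable M \<longleftrightarrow> (\<exists>\<xi>. F_parameterization M \<xi> \<and>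
     (\<exists>\<Xi> p. HF_definable_fun M \<Xi> \<and> HF_definable_fun M p \<and>
        (\<forall>x\<in>universe M. \<forall>m. \<Xi> x m = \<xi> x m) \<and>
        (\<forall>f :: nat \<Rightarrow> nat. \<exists>x\<in>universe M. \<forall>n. p x n = f n)))"


section \<open>Blum--Shub--Smale machines over the reals\<close>

text \<open>\<open>int \<Rightarrow>\<^sub>0 real\<close> is the direct sum of copies of the reals indexed by the integers, and
  \<open>real list\<close> is the set of finite sequences. Polynomials have real coefficients and
  finitely many of the integer-indexed coordinates as variables.\<close>

abbreviation "lookup \<equiv> Poly_Mapping.lookup"
abbreviation "keys \<equiv> Poly_Mapping.keys"

type_synonym rpoly = "(int \<Rightarrow>\<^sub>0 nat) \<Rightarrow>\<^sub>0 real"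

definition rpoly_eval :: "rpoly \<Rightarrow> (int \<Rightarrow>\<^sub>0 real) \<Rightarrow> real" where
  "rpoly_eval p x = (\<Sum>m\<in>keys p. lookup p m * (\<Prod>i\<in>keys m. lookup x i ^ lookup m i))"

definition lin_eval :: "(int \<Rightarrow>\<^sub>0 real) \<Rightarrow> (int \<Rightarrow>\<^sub>0 real) \<Rightarrow> real" where
  "lin_eval c x = (\<Sum>j\<in>keys c. lookup c j * lookup x j)"

definition override :: "(int \<Rightarrow>\<^sub>0 real) \<Rightarrow> (int \<rightharpoonup> real) \<Rightarrow> (int \<Rightarrow>\<^sub>0 real)" where
  "override x u = Abs_poly_mapping (\<lambda>i. case u i of None \<Rightarrow> lookup x i | Some r \<Rightarrow> r)"

lemma lookup_override:
  assumes "finite (dom u)"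
  shows "lookup (override x u) i = (case u i of None \<Rightarrow> lookup x i | Some r \<Rightarrow> r)"
proof -
  have "{i. (case u i of None \<Rightarrow> lookup x i | Some r \<Rightarrow> r) \<noteq> 0} \<subseteq> dom u \<union> keys x"
    by (auto simp: in_keys_iff split: option.splits)
  then have "finite {i. (case u i of None \<Rightarrow> lookup x i | Some r \<Rightarrow> r) \<noteq> 0}"
    by (rule finite_subset) (simp add: assms)
  then show ?thesis
    by (simp add: override_def)
qed

text \<open>Linear and rational maps are given by finitely many real constants: finitely many
  coordinates are replaced by linear forms (quotients of polynomials) and all other
  coordinates are left unchanged. A rational map is undefined where one of its denominators
  vanishes.\<close>

type_synonym lin_map = "int \<rightharpoonup> (int \<Rightarrow>\<^sub>0 real)"
type_synonym rat_map = "int \<rightharpoonup> (rpoly \<times> rpoly)"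

definition lin_apply :: "lin_map \<Rightarrow> (int \<Rightarrow>\<^sub>0 real) \<Rightarrow> (int \<Rightarrow>\<^sub>0 real)" where
  "lin_apply L x = override x (\<lambda>i. map_option (\<lambda>c. lin_eval c x) (L i))"

definition rat_defined :: "rat_map \<Rightarrow> (int \<Rightarrow>\<^sub>0 real) \<Rightarrow> bool" where
  "rat_defined g x \<longleftrightarrow> (\<forall>(p, q)\<in>ran g. rpoly_eval q x \<noteq> 0)"

definition rat_apply :: "rat_map \<Rightarrow> (int \<Rightarrow>\<^sub>0 real) \<Rightarrow> (int \<Rightarrow>\<^sub>0 real)" where
  "rat_apply g x = override x (\<lambda>i. map_option (\<lambda>(p, q). rpoly_eval p x / rpoly_eval q x) (g i))"

definition shift_left :: "(int \<Rightarrow>\<^sub>0 real) \<Rightarrow> (int \<Rightarrow>\<^sub>0 real)" where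
  "shift_left x = Poly_Mapping.map_key (\<lambda>i. i + 1) x"

definition shift_right :: "(int \<Rightarrow>\<^sub>0 real) \<Rightarrow> (int \<Rightarrow>\<^sub>0 real)" where
  "shift_right x = Poly_Mapping.map_key (\<lambda>i. i - 1) x"

lemma lookup_shift_left: "lookup (shift_left x) i = lookup x (i + 1)"
proof -
  have "inj (\<lambda>i :: int. i + 1)"
    by (simp add: inj_def)
  then show ?thesis
    unfolding shift_left_def by (simp only: map_key.rep_eq if_True comp_def)
qed

lemma lookup_shift_right: "lookup (shift_right x) i = lookup x (i - 1)"
proof -
  have "inj (\<lambda>i :: int. i - 1)"
    by (simp add: inj_def)
  then show ?thesis
    unfolding shift_right_def by (simp only: map_key.rep_eq if_True comp_def)
qed

text \<open>A finite sequence \<open>x\<^sub>1, \<dots>, x\<^sub>n\<close> is placed at the positions \<open>1, \<dots>, n\<close>. Its length is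
  recorded in unary by ones at the positions \<open>0, -1, \<dots>, -(n-1)\<close>, since sequences of
  different lengths that agree up to trailing zeros could not be told apart otherwise.
  Output is read off in the same format.\<close>

definition embed_seq :: "real list \<Rightarrow> (int \<Rightarrow>\<^sub>0 real)" where
  "embed_seq xs = Abs_poly_mapping (\<lambda>i.
     if 1 \<le> i \<and> i \<le> int (length xs) then xs ! nat (i - 1)
     else if - int (length xs) < i \<and> i \<le> 0 then 1 else 0)"

lemma lookup_embed_seq:
  "lookup (embed_seq xs) i =
    (if 1 \<le> i \<and> i \<le> int (length xs) then xs ! nat (i - 1)
     else if - int (length xs) < i \<and> i \<le> 0 then 1 else 0)"
proof -
  let ?f = "\<lambda>i. if 1 \<le> i \<and> i \<le> int (length xs) then xs ! nat (i - 1)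
     else if - int (length xs) < i \<and> i \<le> 0 then 1 else 0"
  have "{i. ?f i \<noteq> 0} \<subseteq> {- int (length xs)..int (length xs)}"
    by auto
  then have "finite {i. ?f i \<noteq> 0}"
    by (rule finite_subset) simp
  then show ?thesis
    by (simp add: embed_seq_def)
qed

definition read_seq :: "(int \<Rightarrow>\<^sub>0 real) \<Rightarrow> real list" where
  "read_seq x = map (\<lambda>i. lookup x (int i)) [1..<Suc (LEAST l. lookup x (- int l) \<noteq> 1)]"

text \<open>The last arguments of a node are its successors. A branch node carrying \<open>h\<close> continues
  at the first successor if \<open>h \<ge> 0\<close> and at the second one if \<open>h < 0\<close>.\<close>

datatype bss_node =
    Input lin_map nat
  | Computation rat_map nat
  | Branch rpoly nat nat
  | Shift_Left nat
  | Shift_Right nat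
  | Output lin_map

record bss_machine =
  nodes :: "nat set"
  label :: "nat \<Rightarrow> bss_node"

primrec successors :: "bss_node \<Rightarrow> nat set" where
  "successors (Input L r) = {r}"
| "successors (Computation g r) = {r}"
| "successors (Branch h r r') = {r, r'}"
| "successors (Shift_Left r) = {r}"
| "successors (Shift_Right r) = {r}"
| "successors (Output L) = {}"

primrec wf_node :: "bss_node \<Rightarrow> bool" where
  "wf_node (Input L r) \<longleftrightarrow> finite (dom L)"
| "wf_node (Computation g r) \<longleftrightarrow> finite (dom g) \<and> (\<forall>(p, q)\<in>ran g. q \<noteq> 0)"
| "wf_node (Branch h r r') \<longleftrightarrow> True"
| "wf_node (Shift_Left r) \<longleftrightarrow> True"
| "wf_node (Shift_Right r) \<longleftrightarrow> True"
| "wf_node (Output L) \<longleftrightarrow> finite (dom L)"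

definition edges :: "bss_machine \<Rightarrow> (nat \<times> nat) set" where
  "edges T = {(a, b). a \<in> nodes T \<and> b \<in> successors (label T a)}"

definition is_input :: "bss_machine \<Rightarrow> nat \<Rightarrow> bool" where
  "is_input T a \<longleftrightarrow> a \<in> nodes T \<and> (\<exists>L r. label T a = Input L r)"

definition wf_machine :: "bss_machine \<Rightarrow> bool" where
  "wf_machine T \<longleftrightarrow>
     finite (nodes T) \<and>
     (\<forall>a\<in>nodes T. wf_node (label T a) \<and> successors (label T a) \<subseteq> nodes T) \<and>
     (\<forall>a\<in>nodes T. \<forall>b\<in>nodes T. (a, b) \<in> (edges T \<union> (edges T)\<inverse>)\<^sup>*) \<and>
     (\<exists>!a. is_input T a) \<and>
     (\<forall>(a, b)\<in>edges T. \<not> is_input T b)"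

inductive bss_step ::
    "bss_machine \<Rightarrow> nat \<times> (int \<Rightarrow>\<^sub>0 real) \<Rightarrow> nat \<times> (int \<Rightarrow>\<^sub>0 real) \<Rightarrow> bool"
  for T :: bss_machine where
  computation: "label T a = Computation g r \<Longrightarrow> rat_defined g x \<Longrightarrow>
    bss_step T (a, x) (r, rat_apply g x)"
| branch_nonneg: "label T a = Branch h r r' \<Longrightarrow> rpoly_eval h x \<ge> 0 \<Longrightarrow>
    bss_step T (a, x) (r, x)"
| branch_neg: "label T a = Branch h r r' \<Longrightarrow> rpoly_eval h x < 0 \<Longrightarrow>
    bss_step T (a, x) (r', x)"
| shift_left: "label T a = Shift_Left r \<Longrightarrow> bss_step T (a, x) (r, shift_left x)"
| shift_right: "label T a = Shift_Right r \<Longrightarrow> bss_step T (a, x) (r, shift_right x)"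

definition bss_computes :: "bss_machine \<Rightarrow> real list \<Rightarrow> real list \<Rightarrow> bool" where
  "bss_computes T xs ys \<longleftrightarrow> (\<exists>a L r b L' z.
     a \<in> nodes T \<and> label T a = Input L r \<and>
     (bss_step T)\<^sup>*\<^sup>* (r, lin_apply L (embed_seq xs)) (b, z) \<and>
     label T b = Output L' \<and> ys = read_seq (lin_apply L' z))"

definition R_computable_set :: "real list set \<Rightarrow> bool" where
  "R_computable_set S \<longleftrightarrow>
     (\<exists>T. wf_machine T \<and> (\<forall>xs. bss_computes T xs (if xs \<in> S then [1] else [0])))"

text \<open>A tuple of finite sequences is coded as one finite sequence by prefixing each component
  with its length.\<close>

definition tuple_code :: "real list list \<Rightarrow> real list" where
  "tuple_code xss = concat (map (\<lambda>xs. real (length xs) # xs) xss)"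

definition R_computable :: "('s::finite, real list) struct \<Rightarrow> bool" where
  "R_computable M \<longleftrightarrow> R_computable_set (universe M) \<and>
     (\<forall>s. R_computable_set (tuple_code ` interp M s))"


section \<open>The real field with exponentiation\<close>

datatype exp_sym = Plus | Times | Zero | One | Exp

instance exp_sym :: finite
proof
  have "(UNIV :: exp_sym set) = {Plus, Times, Zero, One, Exp}"
    by (rule UNIV_eq_I, case_tac x) simp_all
  then show "finite (UNIV :: exp_sym set)"
    by (rule ssubst) simp
qed

definition real_exp_struct :: "(exp_sym, real) struct" where
  "real_exp_struct = \<lparr>universe = UNIV,
     arity = (\<lambda>s. case s of Plus \<Rightarrow> 3 | Times \<Rightarrow> 3 | Zero \<Rightarrow> 1 | One \<Rightarrow> 1 | Exp \<Rightarrow> 2),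
     interp = (\<lambda>s. case s of
         Plus \<Rightarrow> {[x, y, x + y] | x y. True}
       | Times \<Rightarrow> {[x, y, x * y] | x y. True}
       | Zero \<Rightarrow> {[0]}
       | One \<Rightarrow> {[1]}
       | Exp \<Rightarrow> {[x, exp x] | x. True})\<rparr>"

end

theory Submission
  imports Defs "HOL-Computational_Algebra.Polynomial"
begin

text \<open>
  Selfparameterization. The coding \<open>\<xi>(x)(m) = \<lfloor>m e\<^sup>x\<rfloor>\<close> is injective. In the
  superstructure the number \<open>n\<close> and the real \<open>n\<close> are linked by a finite set that counts up to
  \<open>n\<close>, so arithmetic on von Neumann ordinals becomes arithmetic of reals and \<open>\<xi>\<close> is definable.
  A function \<open>f\<close> is represented by a real whose base-4 digit at position \<open>(n + k)\<^sup>2 + n\<close> is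
  \<open>1\<close> if \<open>k = f n\<close> and \<open>0\<close> otherwise; powers of 4 are definable by means of \<open>exp\<close>. The
  analyticity conditions follow since a nonempty closed subset of Baire space is a retract of it.

  Noncomputability. For a machine with countably many constants there is an \<open>x\<close> such that \<open>e\<^sup>x\<close>
  is transcendental over the field generated by \<open>x\<close> and the constants, because a nonzero polynomial
  \<open>P(x, e\<^sup>x)\<close> has only finitely many zeros. Run the machine on \<open>(x, y)\<close> with \<open>x\<close> fixed: along
  the path taken at \<open>y = e\<^sup>x\<close> all registers are rational functions of \<open>y\<close>, and each
  of them is either identically zero or nonzero at \<open>e\<^sup>x\<close>. Hence the same path is taken, with the
  same answer, for all \<open>y\<close> near \<open>e\<^sup>x\<close>.
\<close>

section \<open>Analyticity of the coding\<close>

lemma open_cylinder: "open {b :: nat \<Rightarrow> nat. \<forall>i<n. b i = a i}"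
proof -
  have "{b. \<forall>i<n. b i = a i} = (\<Inter>i\<in>{..<n}. (\<lambda>b. b i) -` {a i})" by auto
  also have "open \<dots>"
    by (intro open_INT ballI open_vimage continuous_on_product_coordinates) (auto simp: open_discrete)
  finally show ?thesis .
qed

text \<open>Such a function is constant on each cylinder of length \<open>n\<close>, so preimages of
  arbitrary sets are open.\<close>

lemma continuous_on_prefix_dependent:
  fixes f :: "(nat \<Rightarrow> nat) \<Rightarrow> 'b::topological_space"
  assumes "\<And>a b. (\<And>i. i < n \<Longrightarrow> a i = b i) \<Longrightarrow> f a = f b"
  shows "continuous_on UNIV f"
proof -
  have "open (f -` B)" for B
  proof (subst open_subopen, safe)
    fix a assume a: "f a \<in> B"
    show "\<exists>T. open T \<and> a \<in> T \<and> T \<subseteq> f -` B"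
    proof (intro exI conjI)
      show "open {b. \<forall>i<n. b i = a i}" by (rule open_cylinder)
      show "{b. \<forall>i<n. b i = a i} \<subseteq> f -` B"
      proof
        fix b assume "b \<in> {b. \<forall>i<n. b i = a i}"
        then have "f b = f a" by (intro assms) simp
        then show "b \<in> f -` B" using a by simp
      qed
    qed simp
  qed
  then show ?thesis by (simp add: continuous_on_open_vimage)
qed

text \<open>Points of \<open>K\<close> that share ever longer prefixes with \<open>b\<close>
  converge to \<open>b\<close> in every coordinate, which is convergence in the product
  topology.\<close>

lemma closed_prefix_limit:
  fixes K :: "(nat \<Rightarrow> nat) set"
  assumes "closed K" and "\<And>n. \<exists>c\<in>K. \<forall>i<n. c i = b i"
  shows "b \<in> K"
proof -
  obtain c where c: "\<And>n. c n \<in> K" "\<And>n i. i < n \<Longrightarrow> c n i = b i"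
    using assms(2) by metis
  have "(\<lambda>n. c n i) \<longlonglongrightarrow> b i" for i
    by (rule tendsto_eventually, rule eventually_sequentiallyI[of "Suc i"]) (simp add: c)
  then have "limitin (product_topology (\<lambda>_. euclidean) UNIV) c b sequentially"
    by (simp add: limitin_componentwise)
  then have "c \<longlonglongrightarrow> b"
    by (simp add: euclidean_product_topology)
  then show ?thesis
    using closed_sequentially[OF assms(1)] c(1) by blast
qed

context
  fixes K :: "(nat \<Rightarrow> nat) set"
begin

text \<open>Membership of \<open>s @ [k]\<close> in the tree of finite prefixes of
  \<open>K\<close>.\<close>

definition extendible :: "nat list \<Rightarrow> nat \<Rightarrow> bool" where
  "extendible s k \<longleftrightarrow> (\<exists>c\<in>K. map c [0..<Suc (length s)] = s @ [k])"

text \<open>An entry of \<open>a\<close> is copied whenever this keeps the prefix in the tree;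
  otherwise an arbitrary child of the current node is taken. Points of \<open>K\<close> are
  therefore never altered.\<close>

primrec tree_retract_prefix :: "(nat \<Rightarrow> nat) \<Rightarrow> nat \<Rightarrow> nat list" where
  "tree_retract_prefix a 0 = []"
| "tree_retract_prefix a (Suc n) = tree_retract_prefix a n @
     [if extendible (tree_retract_prefix a n) (a n) then a n
      else SOME k. extendible (tree_retract_prefix a n) k]"

definition tree_retract :: "(nat \<Rightarrow> nat) \<Rightarrow> nat \<Rightarrow> nat" where
  "tree_retract a i = tree_retract_prefix a (Suc i) ! i"

lemma length_tree_retract_prefix [simp]: "length (tree_retract_prefix a n) = n"
  by (induction n) auto

lemma tree_retract_prefix_eq: "tree_retract_prefix a n = map (tree_retract a) [0..<n]"
proof (induction n)
  case (Suc n)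
  have "tree_retract_prefix a (Suc n) ! n = tree_retract a n" by (simp add: tree_retract_def)
  moreover have "tree_retract_prefix a (Suc n) = tree_retract_prefix a n @ [tree_retract_prefix a (Suc n) ! n]"
    by (simp add: nth_append)
  ultimately show ?case using Suc by simp
qed simp

text \<open>A point of \<open>K\<close> witnessing one prefix supplies a child of that node through
  its next entry, so the choice by \<open>SOME\<close> always succeeds.\<close>

lemma tree_retract_prefix_in_tree:
  assumes "K \<noteq> {}" shows "\<exists>c\<in>K. map c [0..<n] = tree_retract_prefix a n"
proof (induction n)
  case 0
  then show ?case using assms by auto
next
  case (Suc n)
  then obtain c where "c \<in> K" "map c [0..<n] = tree_retract_prefix a n" by blast
  then have "extendible (tree_retract_prefix a n) (c n)"
    unfolding extendible_def by (intro bexI[of _ c]) auto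
  then have "extendible (tree_retract_prefix a n) (if extendible (tree_retract_prefix a n) (a n) then a n
      else SOME k. extendible (tree_retract_prefix a n) k)" (is "extendible _ ?k")
    by (auto intro: someI)
  then obtain c where "c \<in> K" "map c [0..<Suc n] = tree_retract_prefix a n @ [?k]"
    unfolding extendible_def length_tree_retract_prefix by blast
  then show ?case by (intro bexI[of _ c]) (simp_all only: tree_retract_prefix.simps)
qed

lemma tree_retract_prefix_cong:
  "(\<And>i. i < n \<Longrightarrow> a i = b i) \<Longrightarrow> tree_retract_prefix a n = tree_retract_prefix b n"
  by (induction n) auto

lemma continuous_on_tree_retract: "continuous_on UNIV tree_retract"
proof (intro continuous_on_coordinatewise_then_product continuous_on_prefix_dependent)
  fix i :: nat and a b :: "nat \<Rightarrow> nat" assume "\<And>j. j < Suc i \<Longrightarrow> a j = b j"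
  then have "tree_retract_prefix a (Suc i) = tree_retract_prefix b (Suc i)" by (rule tree_retract_prefix_cong)
  then show "tree_retract a i = tree_retract b i" by (simp only: tree_retract_def)
qed

lemma tree_retract_fixes:
  assumes "a \<in> K" shows "tree_retract a = a"
proof -
  have "tree_retract_prefix a n = map a [0..<n]" for n
  proof (induction n)
    case (Suc n)
    have "extendible (map a [0..<n]) (a n)"
      unfolding extendible_def by (intro bexI[OF _ assms]) simp
    with Suc show ?case by simp
  qed simp
  then show ?thesis by (simp add: tree_retract_def fun_eq_iff del: tree_retract_prefix.simps upt_Suc)
qed

text \<open>Closedness turns the fact that all prefixes of a value lie in the tree into membership
  of the value in \<open>K\<close>.\<close>

lemma range_tree_retract:
  assumes "closed K" "K \<noteq> {}" shows "range tree_retract = K"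
proof
  show "K \<subseteq> range tree_retract" using tree_retract_fixes by (metis rangeI subsetI)
  show "range tree_retract \<subseteq> K"
  proof safe
    fix a
    show "tree_retract a \<in> K"
    proof (rule closed_prefix_limit[OF assms(1)])
      fix n
      show "\<exists>c\<in>K. \<forall>i<n. c i = tree_retract a i"
        using tree_retract_prefix_in_tree[OF assms(2), of n a] unfolding tree_retract_prefix_eq map_eq_conv set_upt
        by (metis atLeastLessThan_iff zero_le)
    qed
  qed
qed

end

text \<open>Precomposing with the retraction extends the domain from \<open>K\<close> to all of
  Baire space, as \<open>analytic_in\<close> demands.\<close>

lemma analytic_in_image_closed:
  fixes K :: "(nat \<Rightarrow> nat) set"
  assumes "closed K" "continuous_map euclidean X f"
  shows "analytic_in X (f ` K)"
proof (cases "K = {}")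
  case False
  have "continuous_map euclidean X (f \<circ> tree_retract K)"
    using continuous_on_tree_retract assms(2) by (intro continuous_map_compose) auto
  moreover have "f ` K = range (f \<circ> tree_retract K)"
    using range_tree_retract[OF assms(1) False] by (metis image_comp)
  ultimately show ?thesis by (auto simp: analytic_in_def)
qed (simp add: analytic_in_def)

section \<open>A continuous surjection from Baire space onto the reals\<close>

text \<open>The entry at 0 codes an integer and the parities of the other entries are binary digits
  after the point; taking parities makes every sequence a valid code.\<close>

definition binary_real :: "(nat \<Rightarrow> nat) \<Rightarrow> real" where
  "binary_real a = of_int (int_decode (a 0)) + suminf (\<lambda>n. real (a (Suc n) mod 2) / 2 ^ Suc n)"

text \<open>Partial sums read finitely many entries, and by the Weierstrass test they converge
  uniformly.\<close>

lemma continuous_on_binary_real: "continuous_on UNIV binary_real"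
proof -
  let ?f = "\<lambda>n (a :: nat \<Rightarrow> nat). real (a (Suc n) mod 2) / 2 ^ Suc n"
  have lim: "uniform_limit UNIV (\<lambda>n a. \<Sum>i<n. ?f i a) (\<lambda>a. suminf (\<lambda>i. ?f i a)) sequentially"
  proof (rule Weierstrass_m_test)
    show "norm (?f n a) \<le> (1 / 2) ^ Suc n" for n a
    proof -
      have "real (a (Suc n) mod 2) \<le> 1" by simp
      then show ?thesis by (simp add: power_divide field_simps)
    qed
    show "summable (\<lambda>n. (1 / 2 :: real) ^ Suc n)"
      by (subst summable_Suc_iff) (rule summable_geometric, simp)
  qed
  have "continuous_on UNIV (\<lambda>a. suminf (\<lambda>i. ?f i a))"
  proof (rule uniform_limit_theorem[OF _ lim])
    show "\<forall>\<^sub>F n in sequentially. continuous_on UNIV (\<lambda>a. \<Sum>i<n. ?f i a)"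
    proof (intro always_eventually allI continuous_on_sum)
      fix i n :: nat
      show "continuous_on UNIV (?f i)"
        by (rule continuous_on_prefix_dependent[of "Suc (Suc i)"]) simp
    qed
  qed simp
  moreover have "continuous_on UNIV (\<lambda>a :: nat \<Rightarrow> nat. real_of_int (int_decode (a 0)))"
    by (rule continuous_on_prefix_dependent[of 1]) simp
  ultimately show ?thesis
    unfolding binary_real_def[abs_def] by (intro continuous_on_add)
qed

lemma floor_power_div_tendsto: "(\<lambda>n. of_int \<lfloor>2 ^ n * x\<rfloor> / 2 ^ n) \<longlonglongrightarrow> (x :: real)"
proof (rule tendsto_sandwich)
  show "\<forall>\<^sub>F n in sequentially. x - (1 / 2) ^ n \<le> of_int \<lfloor>2 ^ n * x\<rfloor> / 2 ^ n"
  proof (intro always_eventually allI)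
    fix n
    have "2 ^ n * x - 1 \<le> of_int \<lfloor>2 ^ n * x\<rfloor>" by linarith
    then have "(2 ^ n * x - 1) / 2 ^ n \<le> of_int \<lfloor>2 ^ n * x\<rfloor> / 2 ^ n"
      by (intro divide_right_mono) auto
    then show "x - (1 / 2) ^ n \<le> of_int \<lfloor>2 ^ n * x\<rfloor> / 2 ^ n"
      by (simp add: diff_divide_distrib power_divide)
  qed
  show "\<forall>\<^sub>F n in sequentially. of_int \<lfloor>2 ^ n * x\<rfloor> / 2 ^ n \<le> x"
    by (intro always_eventually allI) (simp add: field_simps)
  have "(\<lambda>n. x - (1 / 2) ^ n) \<longlonglongrightarrow> x - 0"
    by (intro tendsto_diff tendsto_const LIMSEQ_power_zero) simp
  then show "(\<lambda>n. x - (1 / 2) ^ n) \<longlonglongrightarrow> x" by simp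
qed simp

lemma surj_binary_real: "range binary_real = UNIV"
proof -
  have "x \<in> range binary_real" for x
  proof -
    define b where "b n = \<lfloor>2 ^ n * x\<rfloor>" for n
    have b: "b (Suc n) = 2 * b n \<or> b (Suc n) = 2 * b n + 1" for n
    proof -
      have "of_int (b n) \<le> 2 ^ n * x" "2 ^ n * x < of_int (b n) + 1"
        by (auto simp: b_def)
      then show ?thesis
        unfolding b_def by (simp add: floor_eq_iff) linarith
    qed
    define a where "a n = (case n of 0 \<Rightarrow> int_encode (b 0) | Suc n \<Rightarrow> nat (b (Suc n) - 2 * b n))" for n
    \<comment> \<open>Each digit term is the difference of two consecutive dyadic truncations of
      \<open>x\<close>, so the series telescopes.\<close>
    have eq: "real (a (Suc n) mod 2) / 2 ^ Suc n = b (Suc n) / 2 ^ Suc n - b n / 2 ^ n" for n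
      using b[of n] by (auto simp: a_def field_simps)
    have "(\<lambda>n. real (a (Suc n) mod 2) / 2 ^ Suc n) sums (x - b 0 / 2 ^ 0)"
      unfolding eq using floor_power_div_tendsto[of x]
      by (intro telescope_sums) (simp add: b_def)
    then have "binary_real a = x"
      by (simp add: binary_real_def a_def sums_iff)
    then show ?thesis by blast
  qed
  then show ?thesis by blast
qed

section \<open>Integer parts of multiples as codes of reals\<close>

text \<open>Multiples of \<open>exp x\<close> are nonnegative, so \<open>nat\<close> loses no
  information; multiples of \<open>x\<close> would not have this property.\<close>

definition floor_code :: "real \<Rightarrow> nat \<Rightarrow> nat" where
  "floor_code x m = nat \<lfloor>real m * exp x\<rfloor>"

lemma floor_code_eq_iff:
  "floor_code x m = k \<longleftrightarrow> real k \<le> real m * exp x \<and> real m * exp x < real k + 1"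
  by (simp add: floor_code_def nat_eq_iff floor_eq_iff)

text \<open>If two exponentials differ, some multiple of their difference exceeds 1, and then the
  integer parts differ.\<close>

lemma inj_floor_code: "inj floor_code"
proof (rule injI)
  have le: "exp x \<le> exp y" if eq: "floor_code x = floor_code y" for x y
  proof (rule ccontr)
    assume "\<not> exp x \<le> exp y"
    then obtain m :: nat where "1 < real m * (exp x - exp y)"
      using reals_Archimedean3[of "exp x - exp y"] by auto
    moreover have "real m * exp x < real (floor_code x m) + 1" "real (floor_code y m) \<le> real m * exp y"
      using floor_code_eq_iff by blast+
    ultimately show False using eq by (simp add: algebra_simps)
  qed
  fix x y assume "floor_code x = floor_code y"
  then show "x = y" using le[of x y] le[of y x] by simp
qed

text \<open>Column \<open>j\<close> of a sequence read as a matrix. In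
  \<open>floor_code_tree\<close>, column 0 holds the parameter, column \<open>2 * i + 1\<close> the
  code of the \<open>i\<close>-th real and column \<open>2 * i + 2\<close> its gap
  witnesses.\<close>

definition subseq_at :: "nat \<Rightarrow> (nat \<Rightarrow> nat) \<Rightarrow> nat \<Rightarrow> nat" where
  "subseq_at j w = (\<lambda>n. w (prod_encode (j, n)))"

lemma continuous_on_subseq_at: "continuous_on UNIV (subseq_at j)"
  unfolding subseq_at_def[abs_def]
  by (intro continuous_on_coordinatewise_then_product continuous_on_product_coordinates)

text \<open>The strict inequality in \<open>floor_code_eq_iff\<close> becomes a closed condition once a witness for
  the size of the gap is stored in a subseq_at of its own.\<close>

definition floor_code_tree :: "nat \<Rightarrow> (nat \<Rightarrow> (nat \<Rightarrow> nat) \<Rightarrow> real) \<Rightarrow> (nat \<Rightarrow> nat) set" where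
  "floor_code_tree k g = {w. \<forall>i<k. \<forall>m.
     real (subseq_at (2 * i + 1) w m) \<le> real m * exp (g i (subseq_at 0 w)) \<and>
     real m * exp (g i (subseq_at 0 w)) \<le>
       real (subseq_at (2 * i + 1) w m) + 1 - inverse (real (Suc (subseq_at (2 * i + 2) w m)))}"

lemma closed_floor_code_tree:
  assumes "\<And>i. i < k \<Longrightarrow> continuous_on UNIV (g i)"
  shows "closed (floor_code_tree k g)"
proof -
  have "continuous_on UNIV (\<lambda>w. f (subseq_at j w m))" for j m and f :: "nat \<Rightarrow> real"
    unfolding subseq_at_def
    by (rule continuous_on_prefix_dependent[of "Suc (prod_encode (j, m))"]) simp
  moreover have "continuous_on UNIV (\<lambda>w. g i (subseq_at 0 w))" if "i < k" for i
    using continuous_on_compose2[OF assms[OF that] continuous_on_subseq_at] by simp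
  ultimately have "closed {w. real (subseq_at (2 * i + 1) w m) \<le> real m * exp (g i (subseq_at 0 w)) \<and>
      real m * exp (g i (subseq_at 0 w)) \<le>
        real (subseq_at (2 * i + 1) w m) + 1 - inverse (real (Suc (subseq_at (2 * i + 2) w m)))}"
    if "i < k" for i m
    using that by (intro closed_Collect_conj closed_Collect_le continuous_on_mult continuous_on_add
        continuous_on_diff continuous_on_const continuous_on_exp) auto
  then have "closed (\<Inter>i\<in>{..<k}. \<Inter>m. {w. real (subseq_at (2 * i + 1) w m) \<le> real m * exp (g i (subseq_at 0 w)) \<and>
      real m * exp (g i (subseq_at 0 w)) \<le>
        real (subseq_at (2 * i + 1) w m) + 1 - inverse (real (Suc (subseq_at (2 * i + 2) w m)))})"
    by (intro closed_INT ballI) simp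
  also have "\<dots> = floor_code_tree k g"
    by (auto simp: floor_code_tree_def)
  finally show ?thesis .
qed

lemma subseq_at_floor_code_tree:
  assumes "w \<in> floor_code_tree k g" "i < k"
  shows "subseq_at (2 * i + 1) w = floor_code (g i (subseq_at 0 w))"
proof
  fix m
  have "real (subseq_at (2 * i + 1) w m) \<le> real m * exp (g i (subseq_at 0 w))"
     "real m * exp (g i (subseq_at 0 w)) \<le>
       real (subseq_at (2 * i + 1) w m) + 1 - inverse (real (Suc (subseq_at (2 * i + 2) w m)))"
    using assms unfolding floor_code_tree_def by blast+
  moreover have "inverse (real (Suc (subseq_at (2 * i + 2) w m))) > 0" by simp
  ultimately have "floor_code (g i (subseq_at 0 w)) m = subseq_at (2 * i + 1) w m"
    unfolding floor_code_eq_iff by linarith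
  then show "subseq_at (2 * i + 1) w m = floor_code (g i (subseq_at 0 w)) m" ..
qed

text \<open>The gap below the next integer is positive, hence bounded below by the inverse of a
  positive integer, and the columns can be filled independently of each other.\<close>

lemma floor_code_tree_surj: "\<exists>w\<in>floor_code_tree k g. subseq_at 0 w = d"
proof -
  have "\<exists>j. real m * exp x \<le> real (floor_code x m) + 1 - inverse (real (Suc j))" for x m
  proof -
    have "0 < real (floor_code x m) + 1 - real m * exp x"
      using floor_code_eq_iff[of x m "floor_code x m"] by simp
    then obtain j where "inverse (real (Suc j)) < real (floor_code x m) + 1 - real m * exp x"
      using reals_Archimedean by blast
    then show ?thesis by (intro exI[of _ j]) linarith
  qed
  then have "\<forall>x m. \<exists>j. real m * exp x \<le> real (floor_code x m) + 1 - inverse (real (Suc j))"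
    by blast
  then obtain s where s:
    "\<And>x m. real m * exp x \<le> real (floor_code x m) + 1 - inverse (real (Suc (s x m)))"
    unfolding choice_iff by blast
  \<comment> \<open>For \<open>j = 2 * i + 1\<close> the index \<open>i\<close> is
    \<open>j div 2\<close>; for \<open>j = 2 * i + 2\<close> it is
    \<open>j div 2 - 1\<close>.\<close>
  define w where "w n = (case prod_decode n of (j, m) \<Rightarrow>
    if j = 0 then d m else if odd j then floor_code (g (j div 2) d) m else s (g (j div 2 - 1) d) m)" for n
  have "subseq_at 0 w = d" "subseq_at (2 * i + 1) w = floor_code (g i d)" "subseq_at (2 * i + 2) w = s (g i d)" for i
    by (auto simp: subseq_at_def w_def fun_eq_iff)
  moreover have "real (floor_code x m) \<le> real m * exp x" for x m
    using floor_code_eq_iff by blast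
  ultimately show ?thesis
    using s unfolding floor_code_tree_def by (intro bexI[of _ w]) (auto simp del: of_nat_Suc)
qed

text \<open>\<open>floor_code\<close> is not continuous, so the tuples are obtained instead by
  projecting the closed set \<open>floor_code_tree\<close> to its odd columns.\<close>

lemma analytic_floor_code_tuples:
  fixes k :: nat and g :: "nat \<Rightarrow> (nat \<Rightarrow> nat) \<Rightarrow> real"
  assumes "\<And>i. i < k \<Longrightarrow> continuous_on UNIV (g i)"
  shows "analytic_in (product_topology (\<lambda>_. euclidean) {..<k})
    {restrict (\<lambda>i. floor_code (g i d)) {..<k} | d. True}"
proof -
  let ?f = "\<lambda>w. restrict (\<lambda>i. subseq_at (2 * i + 1) w) {..<k}"
  have "continuous_map euclidean (product_topology (\<lambda>_. euclidean) {..<k}) ?f"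
    using continuous_on_subseq_at by (auto simp: continuous_map_componentwise)
  moreover have "{restrict (\<lambda>i. floor_code (g i d)) {..<k} | d. True} = ?f ` floor_code_tree k g"
  proof safe
    fix d
    obtain w where w: "w \<in> floor_code_tree k g" "subseq_at 0 w = d"
      using floor_code_tree_surj by blast
    then have "restrict (\<lambda>i. floor_code (g i d)) {..<k} = ?f w"
      using subseq_at_floor_code_tree[OF w(1)] by (auto simp: restrict_def)
    then show "restrict (\<lambda>i. floor_code (g i d)) {..<k} \<in> ?f ` floor_code_tree k g"
      using w by blast
  next
    fix w assume w: "w \<in> floor_code_tree k g"
    then have "?f w = restrict (\<lambda>i. floor_code (g i (subseq_at 0 w))) {..<k}"
      using subseq_at_floor_code_tree[OF w] by (auto simp: restrict_def)
    then show "\<exists>d. ?f w = restrict (\<lambda>i. floor_code (g i d)) {..<k} \<and> True" by blast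
  qed
  ultimately show ?thesis
    using analytic_in_image_closed[OF closed_floor_code_tree] assms by metis
qed

lemma analytic_range_floor_code: "analytic_in euclidean (range floor_code)"
proof -
  let ?K = "floor_code_tree 1 (\<lambda>_. binary_real)"
  have "range floor_code = subseq_at 1 ` ?K"
  proof safe
    fix x
    obtain d where "x = binary_real d" using surj_binary_real by (metis UNIV_I imageE)
    moreover obtain w where "w \<in> ?K" "subseq_at 0 w = d"
      using floor_code_tree_surj by blast
    ultimately show "floor_code x \<in> subseq_at 1 ` ?K"
      using subseq_at_floor_code_tree[of w 1 "\<lambda>_. binary_real" 0] by (metis add_0 image_eqI less_one mult_0_right)
  next
    fix w assume "w \<in> ?K"
    then show "subseq_at 1 w \<in> range floor_code"
      using subseq_at_floor_code_tree[of w 1 "\<lambda>_. binary_real" 0] by simp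
  qed
  moreover have "closed ?K"
    using continuous_on_binary_real by (intro closed_floor_code_tree)
  ultimately show ?thesis
    using analytic_in_image_closed continuous_on_subseq_at[of 1] by (metis continuous_map_iff_continuous2)
qed

lemma F_parameterization_floor_code: "F_parameterization real_exp_struct floor_code"
  unfolding F_parameterization_def
proof (intro conjI allI)
  show "inj_on floor_code (universe real_exp_struct)"
    by (rule inj_on_subset[OF inj_floor_code subset_UNIV])
  show "analytic_in euclidean (floor_code ` universe real_exp_struct)"
    using analytic_range_floor_code by (simp add: real_exp_struct_def)
  fix s
  let ?h = "\<lambda>j w. binary_real (subseq_at j w)"
  have h: "continuous_on UNIV (?h j)" for j
    using continuous_on_compose2[OF continuous_on_binary_real continuous_on_subseq_at] by simp
  have pair: "\<exists>w. ?h 0 w = x \<and> ?h 1 w = y" for x y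
  proof -
    obtain a b where ab: "binary_real a = x" "binary_real b = y"
      using surj_binary_real by (metis UNIV_I imageE)
    define w where "w n = (case prod_decode n of (j, m) \<Rightarrow> if j = 0 then a m else b m)" for n
    have "subseq_at 0 w = a" "subseq_at 1 w = b" by (auto simp: subseq_at_def w_def)
    with ab show ?thesis by auto
  qed
  \<comment> \<open>Each relation becomes the range of a tuple of continuous functions of
    \<open>w\<close>, whose columns 0 and 1 supply two arbitrary reals.\<close>
  define t :: "exp_sym \<Rightarrow> (nat \<Rightarrow> nat) \<Rightarrow> real list" where
    "t s w = (case s of Plus \<Rightarrow> [?h 0 w, ?h 1 w, ?h 0 w + ?h 1 w]
       | Times \<Rightarrow> [?h 0 w, ?h 1 w, ?h 0 w * ?h 1 w]
       | Zero \<Rightarrow> [0] | One \<Rightarrow> [1] | Exp \<Rightarrow> [?h 0 w, exp (?h 0 w)])" for s w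
  have "interp real_exp_struct s = range (t s)"
    using pair by (cases s) (auto simp: t_def real_exp_struct_def image_iff, metis+)
  then have "{restrict (\<lambda>i. floor_code (as ! i)) {..<arity real_exp_struct s} | as.
      as \<in> interp real_exp_struct s}
    = {restrict (\<lambda>i. floor_code (t s w ! i)) {..<arity real_exp_struct s} | w. True}" by auto
  moreover have "continuous_on UNIV (\<lambda>w. t s w ! i)" if "i < arity real_exp_struct s" for i
    using that h
    by (cases s) (auto simp: t_def real_exp_struct_def less_Suc_eq numeral_3_eq_3 numeral_2_eq_2
        intro!: continuous_intros)
  ultimately show "analytic_in (product_topology (\<lambda>_. euclidean) {..<arity real_exp_struct s})
     {restrict (\<lambda>i. floor_code (as ! i)) {..<arity real_exp_struct s} | as.
        as \<in> interp real_exp_struct s}"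
    using analytic_floor_code_tuples[of "arity real_exp_struct s" "\<lambda>i w. t s w ! i"] by simp
qed


section \<open>Definability in the superstructure\<close>

lemma HF_level_mono: "n \<le> m \<Longrightarrow> HF_level A n \<subseteq> HF_level A m"
proof (rule lift_Suc_mono_le)
  show "HF_level A n \<subseteq> HF_level A (Suc n)" for n
  proof (induction n)
    case (Suc n)
    show ?case
    proof
      fix x assume "x \<in> HF_level A (Suc n)"
      then obtain B where "x = HSet B" "fset B \<subseteq> Urel ` A \<union> HF_level A n" by auto
      then show "x \<in> HF_level A (Suc (Suc n))"
        unfolding HF_level.simps(2)[of A "Suc n"] using Suc by blast
    qed
  qed simp
qed

text \<open>The elements of a finite set lie in finitely many levels, hence together in the largest
  of these. Quantifiers of formulas can thus be read as quantifiers over the whole type.\<close>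

lemma HF_universe_UNIV: "Urel ` UNIV \<union> (\<Union>n. HF_level UNIV n) = UNIV"
proof -
  have "x \<in> Urel ` UNIV \<union> (\<Union>n. HF_level UNIV n)" for x :: "'a hf"
  proof (induction x)
    case (HSet B)
    then have "\<forall>b\<in>fset B. \<exists>n. b \<in> Urel ` UNIV \<union> HF_level UNIV n" by blast
    then obtain l where l: "\<And>b. b \<in> fset B \<Longrightarrow> b \<in> Urel ` UNIV \<union> HF_level UNIV (l b)"
      by metis
    define N where "N = Max (l ` fset B)"
    have "b \<in> Urel ` UNIV \<union> HF_level UNIV N" if "b \<in> fset B" for b
      using l[OF that] HF_level_mono[of "l b" N UNIV] that by (auto simp: N_def)
    then have "HSet B \<in> HF_level UNIV (Suc N)" by auto
    then show ?case by blast
  qed simp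
  then show ?thesis by blast
qed

definition hmem :: "'a hf \<Rightarrow> 'a hf \<Rightarrow> bool" where
  "hmem a b \<longleftrightarrow> (\<exists>B. b = HSet B \<and> a |\<in>| B)"

lemma hmem_simps [simp]: "hmem a (HSet B) \<longleftrightarrow> a |\<in>| B" "\<not> hmem a (Urel x)"
  by (auto simp: hmem_def)

lemma hmem_singleton: "hmem a (HSet {|a|})"
  by simp

lemma hmem_irrefl: "\<not> hmem x x"
proof (induction x)
  case (HSet B)
  then show ?case by (metis hmem_simps(1))
qed simp

abbreviation "HFR \<equiv> HF real_exp_struct"

lemma universe_HFR [simp]: "universe HFR = UNIV"
  using HF_universe_UNIV by (simp add: HF_def real_exp_struct_def Let_def)

lemma interp_HFR_Mem: "interp HFR Mem = {[a, b] | a b. hmem a b}"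
proof -
  have "interp HFR Mem = {[a, HSet B] | a B. a \<in> universe HFR \<and> HSet B \<in> universe HFR \<and> a |\<in>| B}"
    by (simp add: HF_def Let_def)
  then show ?thesis by (auto simp: hmem_def)
qed

lemma interp_HFR_Star:
  "interp HFR (Star s) = map (\<lambda>x. HSet {|Urel x|}) ` interp real_exp_struct s"
  by (auto simp: HF_def Let_def)

section \<open>Definable predicates and definable real terms\<close>

text \<open>Definability is stated for predicates on assignments, so that defining formulas are
  assembled by closure rules and never written out.\<close>

definition hf_pred :: "nat \<Rightarrow> ((nat \<Rightarrow> real hf) \<Rightarrow> bool) \<Rightarrow> bool" where
  "hf_pred n P \<longleftrightarrow> (\<exists>\<phi>. fv \<phi> \<subseteq> {..<n} \<and> (\<forall>v. sat HFR v \<phi> \<longleftrightarrow> P v))"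

lemma hf_predI: "fv \<phi> \<subseteq> {..<n} \<Longrightarrow> (\<And>v. sat HFR v \<phi> \<longleftrightarrow> P v) \<Longrightarrow> hf_pred n P"
  by (auto simp: hf_pred_def)

lemma hf_pred_mono: "hf_pred n P \<Longrightarrow> n \<le> m \<Longrightarrow> hf_pred m P"
  by (force simp: hf_pred_def)

lemma hf_pred_cong: "hf_pred n P \<Longrightarrow> (\<And>v. P v = Q v) \<Longrightarrow> hf_pred n Q"
  by (simp add: hf_pred_def)

lemma hf_pred_var_eq: "i < n \<Longrightarrow> j < n \<Longrightarrow> hf_pred n (\<lambda>v. v i = v j)"
  by (rule hf_predI[of "Eq i j"]) auto

lemma hf_pred_mem: "i < n \<Longrightarrow> j < n \<Longrightarrow> hf_pred n (\<lambda>v. hmem (v i) (v j))"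
  by (rule hf_predI[of "Rel Mem [i, j]"]) (auto simp: interp_HFR_Mem)

lemma hf_pred_not: "hf_pred n P \<Longrightarrow> hf_pred n (\<lambda>v. \<not> P v)"
  unfolding hf_pred_def by (metis fv.simps(3) sat.simps(3))

lemma hf_pred_conj:
  assumes "hf_pred n P" "hf_pred n Q" shows "hf_pred n (\<lambda>v. P v \<and> Q v)"
proof -
  obtain \<phi> \<psi> where "fv \<phi> \<subseteq> {..<n}" "\<And>v. sat HFR v \<phi> \<longleftrightarrow> P v"
    "fv \<psi> \<subseteq> {..<n}" "\<And>v. sat HFR v \<psi> \<longleftrightarrow> Q v"
    using assms by (auto simp: hf_pred_def)
  then show ?thesis by (intro hf_predI[of "Conj \<phi> \<psi>"]) auto
qed

lemma hf_pred_disj: "hf_pred n P \<Longrightarrow> hf_pred n Q \<Longrightarrow> hf_pred n (\<lambda>v. P v \<or> Q v)"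
  using hf_pred_not[OF hf_pred_conj[OF hf_pred_not[of n P] hf_pred_not[of n Q]]] by simp

lemma hf_pred_imp: "hf_pred n P \<Longrightarrow> hf_pred n Q \<Longrightarrow> hf_pred n (\<lambda>v. P v \<longrightarrow> Q v)"
  unfolding imp_conv_disj by (intro hf_pred_disj hf_pred_not)

lemma hf_pred_iff: "hf_pred n P \<Longrightarrow> hf_pred n Q \<Longrightarrow> hf_pred n (\<lambda>v. P v \<longleftrightarrow> Q v)"
  unfolding iff_conv_conj_imp by (intro hf_pred_conj hf_pred_imp)

text \<open>Variables act as de Bruijn levels: the bound one takes the index \<open>n\<close>, which
  is fresh for the result, and the second assumption says that \<open>Q\<close> does not read
  it.\<close>

lemma hf_pred_ex:
  assumes "hf_pred (Suc n) (\<lambda>v. Q v (v n))" "\<And>v a b. Q (v(n := a)) b = Q v b"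
  shows "hf_pred n (\<lambda>v. \<exists>b. Q v b)"
proof -
  obtain \<phi> where "fv \<phi> \<subseteq> {..<Suc n}" "\<And>v. sat HFR v \<phi> \<longleftrightarrow> Q v (v n)"
    using assms(1) by (auto simp: hf_pred_def)
  then show ?thesis using assms(2) by (intro hf_predI[of "Ex n \<phi>"]) (auto simp: less_Suc_eq)
qed

lemma hf_pred_all:
  assumes "hf_pred (Suc n) (\<lambda>v. Q v (v n))" "\<And>v a b. Q (v(n := a)) b = Q v b"
  shows "hf_pred n (\<lambda>v. \<forall>b. Q v b)"
proof -
  have "hf_pred n (\<lambda>v. \<not> (\<exists>b. \<not> Q v b))"
    using assms by (intro hf_pred_not hf_pred_ex) auto
  then show ?thesis by simp
qed

lemma hf_pred_star:
  assumes "set is \<subseteq> {..<n}"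
  shows "hf_pred n (\<lambda>v. map v is \<in> map (\<lambda>x. HSet {|Urel x|}) ` interp real_exp_struct s)"
  using assms by (intro hf_predI[of "Rel (Star s) is"]) (auto simp: interp_HFR_Star)

text \<open>\<open>Star s\<close> speaks of singletons of urelements. A set that satisfies it and
  contains \<open>v i\<close> can only be the singleton of \<open>v i\<close>.\<close>

lemma hf_pred_interp1:
  assumes "i < n"
  shows "hf_pred n (\<lambda>v. \<exists>x. v i = Urel x \<and> [x] \<in> interp real_exp_struct s)"
proof -
  have "hf_pred n (\<lambda>v. \<exists>a. hmem (v i) a \<and>
      [a] \<in> map (\<lambda>x. HSet {|Urel x|}) ` interp real_exp_struct s)"
    using assms hf_pred_star[of "[n]" "Suc n" s]
    by (intro hf_pred_ex hf_pred_conj hf_pred_mem) auto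
  then show ?thesis
    by (rule hf_pred_cong) (auto simp: image_iff Cons_eq_map_conv, metis hmem_singleton)
qed

lemma hf_pred_interp2:
  assumes "i < n" "j < n"
  shows "hf_pred n (\<lambda>v. \<exists>x y. v i = Urel x \<and> v j = Urel y \<and> [x, y] \<in> interp real_exp_struct s)"
proof -
  have "hf_pred n (\<lambda>v. \<exists>a b. hmem (v i) a \<and> hmem (v j) b \<and>
      [a, b] \<in> map (\<lambda>x. HSet {|Urel x|}) ` interp real_exp_struct s)"
    using assms hf_pred_star[of "[n, Suc n]" "Suc (Suc n)" s]
    by (intro hf_pred_ex hf_pred_conj hf_pred_mem) auto
  then show ?thesis
    by (rule hf_pred_cong) (auto simp: image_iff Cons_eq_map_conv, metis hmem_singleton)
qed

lemma hf_pred_interp3: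
  assumes "i < n" "j < n" "k < n"
  shows "hf_pred n (\<lambda>v. \<exists>x y z. v i = Urel x \<and> v j = Urel y \<and> v k = Urel z \<and>
    [x, y, z] \<in> interp real_exp_struct s)"
proof -
  have "hf_pred n (\<lambda>v. \<exists>a b c. hmem (v i) a \<and> hmem (v j) b \<and> hmem (v k) c \<and>
      [a, b, c] \<in> map (\<lambda>x. HSet {|Urel x|}) ` interp real_exp_struct s)"
    using assms hf_pred_star[of "[n, Suc n, Suc (Suc n)]" "Suc (Suc (Suc n))" s]
    by (intro hf_pred_ex hf_pred_conj hf_pred_mem) auto
  then show ?thesis
    by (rule hf_pred_cong) (auto simp: image_iff Cons_eq_map_conv, metis hmem_singleton)
qed

lemma hf_pred_Urel_0: "i < n \<Longrightarrow> hf_pred n (\<lambda>v. v i = Urel 0)"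
  using hf_pred_interp1[of i n Zero] by (simp add: real_exp_struct_def)

lemma hf_pred_Urel_1: "i < n \<Longrightarrow> hf_pred n (\<lambda>v. v i = Urel 1)"
  using hf_pred_interp1[of i n One] by (simp add: real_exp_struct_def)

lemma hf_pred_Urel_exp:
  "i < n \<Longrightarrow> j < n \<Longrightarrow> hf_pred n (\<lambda>v. \<exists>x. v i = Urel x \<and> v j = Urel (exp x))"
  using hf_pred_interp2[of i n j Exp] by (simp add: real_exp_struct_def)

lemma hf_pred_Urel_add:
  "i < n \<Longrightarrow> j < n \<Longrightarrow> k < n \<Longrightarrow>
   hf_pred n (\<lambda>v. \<exists>x y. v i = Urel x \<and> v j = Urel y \<and> v k = Urel (x + y))"
  using hf_pred_interp3[of i n j k Plus] by (simp add: real_exp_struct_def)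

lemma hf_pred_Urel_mult:
  "i < n \<Longrightarrow> j < n \<Longrightarrow> k < n \<Longrightarrow>
   hf_pred n (\<lambda>v. \<exists>x y. v i = Urel x \<and> v j = Urel y \<and> v k = Urel (x * y))"
  using hf_pred_interp3[of i n j k Times] by (simp add: real_exp_struct_def)

text \<open>Exponentiation is total on the reals, so urelements are exactly the objects that have an
  exponential.\<close>

lemma hf_pred_is_Urel:
  assumes "i < n" shows "hf_pred n (\<lambda>v. v i \<in> range Urel)"
proof -
  have "hf_pred n (\<lambda>v. \<exists>a. \<exists>x. v i = Urel x \<and> a = Urel (exp x))"
    using assms by (intro hf_pred_ex hf_pred_Urel_exp) auto
  then show ?thesis by (rule hf_pred_cong) auto
qed

text \<open>The value of a term is compared with the first variable the term does not depend on.\<close>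

definition hf_term :: "nat \<Rightarrow> ((nat \<Rightarrow> real hf) \<Rightarrow> real) \<Rightarrow> bool" where
  "hf_term n t \<longleftrightarrow> hf_pred (Suc n) (\<lambda>v. v n = Urel (t v)) \<and>
     (\<forall>v w. (\<forall>i<n. v i = w i) \<longrightarrow> t v = t w)"

lemma hf_term_upd: "hf_term n t \<Longrightarrow> n \<le> m \<Longrightarrow> t (v(m := a)) = t v"
  by (auto simp: hf_term_def)

lemma hf_term_Suc:
  assumes "hf_term n t" shows "hf_term (Suc n) t"
proof -
  obtain \<phi> where \<phi>: "fv \<phi> \<subseteq> {..<Suc n}" "\<And>v. sat HFR v \<phi> \<longleftrightarrow> v n = Urel (t v)"
    using assms by (auto simp: hf_term_def hf_pred_def)
  \<comment> \<open>The output variable is renamed without substitution: index \<open>n\<close> is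
    rebound to a copy of variable \<open>Suc n\<close>, where \<open>\<phi>\<close> looks for the
    value.\<close>
  have "hf_pred (Suc (Suc n)) (\<lambda>v. v (Suc n) = Urel (t v))"
    using \<phi> hf_term_upd[OF assms, of n]
    by (intro hf_predI[of "Ex n (Conj (Eq n (Suc n)) \<phi>)"]) auto
  then show ?thesis using assms by (simp add: hf_term_def)
qed

lemma hf_term_mono: "hf_term n t \<Longrightarrow> n \<le> m \<Longrightarrow> hf_term m t"
  by (rotate_tac, induction rule: dec_induct) (auto intro: hf_term_Suc)

lemma hf_pred_var_term: "hf_term n t \<Longrightarrow> n \<le> m \<Longrightarrow> m < k \<Longrightarrow> hf_pred k (\<lambda>v. v m = Urel (t v))"
  using hf_term_mono[of n t m] hf_pred_mono[of "Suc m" "\<lambda>v. v m = Urel (t v)" k]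
  by (simp add: hf_term_def)

lemma hf_term_op1:
  assumes graph: "\<And>n i j. i < n \<Longrightarrow> j < n \<Longrightarrow> hf_pred n (\<lambda>v. \<exists>x. v i = Urel x \<and> v j = Urel (f x))"
    and t: "hf_term n t"
  shows "hf_term n (\<lambda>v. f (t v))"
proof -
  have "hf_pred (Suc n) (\<lambda>v. \<exists>a. a = Urel (t v) \<and> (\<exists>x. a = Urel x \<and> v n = Urel (f x)))"
    using hf_term_upd[OF t]
    by (intro hf_pred_ex hf_pred_conj graph hf_pred_var_term[OF t]) auto
  then have "hf_pred (Suc n) (\<lambda>v. v n = Urel (f (t v)))"
    by (rule hf_pred_cong) auto
  then show ?thesis using t by (auto simp: hf_term_def) metis
qed

lemma hf_term_op2:
  assumes graph: "\<And>n i j k. i < n \<Longrightarrow> j < n \<Longrightarrow> k < n \<Longrightarrow>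
      hf_pred n (\<lambda>v. \<exists>x y. v i = Urel x \<and> v j = Urel y \<and> v k = Urel (f x y))"
    and s: "hf_term n s" and t: "hf_term n t"
  shows "hf_term n (\<lambda>v. f (s v) (t v))"
proof -
  have "hf_pred (Suc n) (\<lambda>v. \<exists>a b. a = Urel (s v) \<and> b = Urel (t v) \<and>
      (\<exists>x y. a = Urel x \<and> b = Urel y \<and> v n = Urel (f x y)))"
    using hf_term_upd[OF s] hf_term_upd[OF t]
    by (intro hf_pred_ex hf_pred_conj graph hf_pred_var_term[OF t] hf_pred_var_term[OF s]) auto
  then have "hf_pred (Suc n) (\<lambda>v. v n = Urel (f (s v) (t v)))"
    by (rule hf_pred_cong) auto
  then show ?thesis using s t by (auto simp: hf_term_def) metis
qed

lemmas hf_term_add = hf_term_op2[OF hf_pred_Urel_add]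
  and hf_term_mult = hf_term_op2[OF hf_pred_Urel_mult]
  and hf_term_exp = hf_term_op1[OF hf_pred_Urel_exp]

lemma hf_term_0: "hf_term n (\<lambda>_. 0)" and hf_term_1: "hf_term n (\<lambda>_. 1)"
  by (auto simp: hf_term_def hf_pred_Urel_0 hf_pred_Urel_1)

lemma hf_pred_eq:
  assumes s: "hf_term n s" and t: "hf_term n t"
  shows "hf_pred n (\<lambda>v. s v = t v)"
proof -
  have "hf_pred n (\<lambda>v. \<exists>a. a = Urel (s v) \<and> a = Urel (t v))"
    using hf_term_upd[OF s] hf_term_upd[OF t]
    by (intro hf_pred_ex hf_pred_conj hf_pred_var_term[OF t] hf_pred_var_term[OF s]) auto
  then show ?thesis by (rule hf_pred_cong) auto
qed

text \<open>\<open>real_of_hf\<close> and \<open>nat_of_hf\<close> below are total, with junk value 0, and surjective: quantifiers over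
  reals and natural numbers thus become unbounded quantifiers over the superstructure.\<close>

primrec real_of_hf :: "real hf \<Rightarrow> real" where
  "real_of_hf (Urel x) = x"
| "real_of_hf (HSet B) = 0"

lemma hf_term_real_of_hf:
  assumes "i < n" shows "hf_term n (\<lambda>v. real_of_hf (v i))"
proof -
  have "hf_pred (Suc n) (\<lambda>v. v i \<in> range Urel \<and> v n = v i \<or> v i \<notin> range Urel \<and> v n = Urel 0)"
    using assms
    by (intro hf_pred_disj hf_pred_conj hf_pred_not hf_pred_is_Urel hf_pred_var_eq hf_pred_Urel_0) auto
  moreover have "(v i \<in> range Urel \<and> v n = v i \<or> v i \<notin> range Urel \<and> v n = Urel 0) \<longleftrightarrow>
      v n = Urel (real_of_hf (v i))" for v
    by (cases "v i") auto
  ultimately show ?thesis using assms by (auto simp: hf_term_def)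
qed

lemma hf_pred_ex_real:
  assumes "hf_pred (Suc n) (\<lambda>v. Q v (real_of_hf (v n)))" "\<And>v a x. Q (v(n := a)) x = Q v x"
  shows "hf_pred n (\<lambda>v. \<exists>x. Q v x)"
proof -
  have "hf_pred n (\<lambda>v. \<exists>a. Q v (real_of_hf a))"
    using assms by (intro hf_pred_ex) auto
  then show ?thesis
    by (rule hf_pred_cong) (metis real_of_hf.simps(1))
qed

text \<open>The language has no order symbol; the nonnegative differences are the squares.\<close>

lemma hf_pred_le:
  assumes s: "hf_term n s" and t: "hf_term n t"
  shows "hf_pred n (\<lambda>v. s v \<le> t v)"
proof -
  have "hf_pred n (\<lambda>v. \<exists>x. s v + x * x = t v)"
    using hf_term_upd[OF s] hf_term_upd[OF t]
    by (intro hf_pred_ex_real hf_pred_eq hf_term_add hf_term_mult hf_term_real_of_hf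
        hf_term_Suc s t) auto
  moreover have "(\<exists>x. s v + x * x = t v) \<longleftrightarrow> s v \<le> t v" for v
  proof
    assume "s v \<le> t v"
    then have "s v + sqrt (t v - s v) * sqrt (t v - s v) = t v" by simp
    then show "\<exists>x. s v + x * x = t v" ..
  qed (metis le_add_same_cancel1 zero_le_square)
  ultimately show ?thesis by simp
qed

lemma hf_pred_less: "hf_term n s \<Longrightarrow> hf_term n t \<Longrightarrow> hf_pred n (\<lambda>v. s v < t v)"
  unfolding not_le[symmetric] by (intro hf_pred_not hf_pred_le)

section \<open>Linking von Neumann numbers with real numbers\<close>

lemma fset_hf_nat_elts: "fset (hf_nat_elts n) = hf_nat ` {..<n}"
  by (induction n) (auto simp: hf_nat_def lessThan_Suc)

lemma hmem_hf_nat: "hmem a (hf_nat n) \<longleftrightarrow> (\<exists>k<n. a = hf_nat k)"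
  by (auto simp: hf_nat_def[of n] fset_hf_nat_elts)

lemma inj_hf_nat: "inj hf_nat"
  by (rule linorder_inj_onI) (auto, metis hmem_hf_nat hmem_irrefl)

text \<open>A finite relation between sets and reals is coded by a set of sets containing a related
  pair each; no ordered pairs are needed since sets and urelements can be told apart.\<close>

definition hf_rel :: "real hf \<Rightarrow> real hf \<Rightarrow> real hf \<Rightarrow> bool" where
  "hf_rel F k s \<longleftrightarrow> s \<in> range Urel \<and> k \<notin> range Urel \<and> (\<exists>q. hmem q F \<and> hmem k q \<and> hmem s q)"

text \<open>The condition looks backwards: a related pair is the initial one or arises from another
  related pair by one step. Well-foundedness of membership then excludes wrong pairs.\<close>

definition counts :: "real hf \<Rightarrow> bool" where
  "counts F \<longleftrightarrow> (\<forall>k s. hf_rel F k s \<longrightarrow>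
     (\<forall>z. \<not> hmem z k) \<and> s = Urel 0 \<or>
     (\<exists>k' s'. hf_rel F k' s' \<and> (\<forall>z. hmem z k \<longleftrightarrow> hmem z k' \<or> z = k') \<and>
        (\<exists>x. s' = Urel x \<and> s = Urel (x + 1))))"

text \<open>The predecessor \<open>k'\<close> is an element of \<open>k\<close>, so structural
  induction on \<open>k\<close> applies.\<close>

lemma counts_imp:
  assumes "counts F" "hf_rel F k s"
  shows "\<exists>n. k = hf_nat n \<and> s = Urel (real n)"
  using assms(2)
proof (induction k arbitrary: s)
  case (Urel x)
  then show ?case by (auto simp: hf_rel_def)
next
  case (HSet B)
  from assms(1) HSet.prems consider "\<forall>z. \<not> hmem z (HSet B)" "s = Urel 0"
    | k' s' x where "hf_rel F k' s'" "\<forall>z. hmem z (HSet B) \<longleftrightarrow> hmem z k' \<or> z = k'"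
       "s' = Urel x" "s = Urel (x + 1)"
    unfolding counts_def by blast
  then show ?case
  proof cases
    case 1
    then have "B = {||}" by auto
    then show ?thesis using 1 by (intro exI[of _ 0]) (simp add: hf_nat_def)
  next
    case 2
    then have "k' \<in> fset B" by auto
    then obtain n where n: "k' = hf_nat n" "s' = Urel (real n)"
      using HSet.IH 2(1) by blast
    have "B = finsert (hf_nat n) (hf_nat_elts n)"
      using 2(2) n(1) by (auto simp: hf_nat_def)
    then have "HSet B = hf_nat (Suc n)" by (simp add: hf_nat_def)
    then show ?thesis using n 2 by (intro exI[of _ "Suc n"]) auto
  qed
qed

lemma counts_iff:
  "(\<exists>F. hf_rel F a b \<and> counts F) \<longleftrightarrow> (\<exists>n. a = hf_nat n \<and> b = Urel (real n))"
proof
  assume "\<exists>n. a = hf_nat n \<and> b = Urel (real n)"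
  then obtain n where n: "a = hf_nat n" "b = Urel (real n)" by blast
  \<comment> \<open>The full record of counting from 0 to \<open>n\<close>, one unordered pair for
    each step.\<close>
  define F where "F = HSet (Abs_fset ((\<lambda>k. HSet {|hf_nat k, Urel (real k)|}) ` {..n}))"
  have memF: "hmem q F \<longleftrightarrow> (\<exists>k\<le>n. q = HSet {|hf_nat k, Urel (real k)|})" for q
    by (auto simp: F_def Abs_fset_inverse)
  have rel: "hf_rel F k s \<longleftrightarrow> (\<exists>j\<le>n. k = hf_nat j \<and> s = Urel (real j))" for k s
    unfolding hf_rel_def memF by (auto simp: hf_nat_def)
  have "counts F"
    unfolding counts_def rel
  proof (intro allI impI, elim exE conjE)
    fix k s j assume j: "j \<le> n" "k = hf_nat j" "s = Urel (real j)"
    show "(\<forall>z. \<not> hmem z k) \<and> s = Urel 0 \<or>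
     (\<exists>k' s'. (\<exists>j\<le>n. k' = hf_nat j \<and> s' = Urel (real j)) \<and>
        (\<forall>z. hmem z k \<longleftrightarrow> hmem z k' \<or> z = k') \<and> (\<exists>x. s' = Urel x \<and> s = Urel (x + 1)))"
    proof (cases j)
      case 0
      then show ?thesis using j by (simp add: hmem_hf_nat)
    next
      case (Suc i)
      then have "\<forall>z. hmem z k \<longleftrightarrow> hmem z (hf_nat i) \<or> z = hf_nat i"
        using j by (auto simp: hmem_hf_nat less_Suc_eq)
      moreover have "s = Urel (real i + 1)" "i \<le> n" using Suc j by auto
      ultimately show ?thesis by blast
    qed
  qed
  moreover have "hf_rel F a b" using n rel by blast
  ultimately show "\<exists>F. hf_rel F a b \<and> counts F" by blast
qed (use counts_imp in blast)

lemma hf_pred_hf_rel: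
  assumes "i < n" "j < n" "k < n" shows "hf_pred n (\<lambda>v. hf_rel (v i) (v j) (v k))"
  unfolding hf_rel_def using assms
  by (intro hf_pred_conj hf_pred_not hf_pred_is_Urel hf_pred_ex hf_pred_mem) auto

lemma hf_pred_Urel_Suc:
  assumes "i < n" "j < n" shows "hf_pred n (\<lambda>v. \<exists>x. v i = Urel x \<and> v j = Urel (x + 1))"
proof -
  have "hf_pred n (\<lambda>v. v i \<in> range Urel \<and> v j \<in> range Urel \<and> real_of_hf (v j) = real_of_hf (v i) + 1)"
    using assms
    by (intro hf_pred_conj hf_pred_is_Urel hf_pred_eq hf_term_add hf_term_1 hf_term_real_of_hf) auto
  then show ?thesis by (rule hf_pred_cong) auto
qed

lemma hf_pred_counts:
  assumes "i < n" shows "hf_pred n (\<lambda>v. counts (v i))"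
  unfolding counts_def
  by (insert assms, (rule hf_pred_Urel_Suc hf_pred_all hf_pred_imp hf_pred_disj hf_pred_conj
      hf_pred_iff hf_pred_not hf_pred_ex hf_pred_hf_rel hf_pred_mem hf_pred_Urel_0 hf_pred_var_eq
      | simp)+)

lemma hf_pred_nat_graph:
  assumes "i < n" "j < n"
  shows "hf_pred n (\<lambda>v. \<exists>m. v i = hf_nat m \<and> v j = Urel (real m))"
  unfolding counts_iff[symmetric] using assms
  by (intro hf_pred_ex hf_pred_conj hf_pred_hf_rel hf_pred_counts) auto

lemma hf_pred_is_nat:
  assumes "i < n" shows "hf_pred n (\<lambda>v. v i \<in> range hf_nat)"
proof -
  have "hf_pred n (\<lambda>v. \<exists>a. \<exists>m. v i = hf_nat m \<and> a = Urel (real m))"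
    using assms by (intro hf_pred_ex hf_pred_nat_graph) auto
  then show ?thesis by (rule hf_pred_cong) auto
qed

definition nat_of_hf :: "real hf \<Rightarrow> nat" where
  "nat_of_hf a = (if a \<in> range hf_nat then inv hf_nat a else 0)"

lemma nat_of_hf_nat [simp]: "nat_of_hf (hf_nat n) = n"
  by (simp add: nat_of_hf_def inv_f_f[OF inj_hf_nat])

lemma hf_term_nat_of_hf:
  assumes "i < n" shows "hf_term n (\<lambda>v. real (nat_of_hf (v i)))"
proof -
  have "hf_pred (Suc n) (\<lambda>v. (\<exists>m. v i = hf_nat m \<and> v n = Urel (real m)) \<or>
      v i \<notin> range hf_nat \<and> v n = Urel 0)"
    using assms
    by (intro hf_pred_disj hf_pred_conj hf_pred_not hf_pred_is_nat hf_pred_nat_graph hf_pred_Urel_0) auto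
  moreover have "((\<exists>m. v i = hf_nat m \<and> v n = Urel (real m)) \<or> v i \<notin> range hf_nat \<and> v n = Urel 0)
      \<longleftrightarrow> v n = Urel (real (nat_of_hf (v i)))" for v
  proof (cases "v i \<in> range hf_nat")
    case True
    then obtain m where "v i = hf_nat m" by blast
    then show ?thesis using inj_hf_nat by (auto dest: injD)
  qed (auto simp: nat_of_hf_def)
  ultimately show ?thesis using assms by (auto simp: hf_term_def)
qed

lemma hf_pred_ex_nat:
  assumes "hf_pred (Suc n) (\<lambda>v. Q v (nat_of_hf (v n)))" "\<And>v a k. Q (v(n := a)) k = Q v k"
  shows "hf_pred n (\<lambda>v. \<exists>k. Q v k)"
proof -
  have "hf_pred n (\<lambda>v. \<exists>a. Q v (nat_of_hf a))"
    using assms by (intro hf_pred_ex) auto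
  then show ?thesis by (rule hf_pred_cong) (metis nat_of_hf_nat)
qed

text \<open>The decoding functions send ill-sorted objects to 0, so the formula also has to demand
  that the three entries have the right sorts.\<close>

lemma HF_definable_funI:
  assumes "hf_pred 3 (\<lambda>v. R (real_of_hf (v 0)) (nat_of_hf (v 1)) (nat_of_hf (v 2)))"
    and "\<And>x m k. R x m k \<longleftrightarrow> F x m = k"
  shows "HF_definable_fun real_exp_struct F"
proof -
  have "hf_pred 3 (\<lambda>v. v 0 \<in> range Urel \<and> v 1 \<in> range hf_nat \<and> v 2 \<in> range hf_nat \<and>
      R (real_of_hf (v 0)) (nat_of_hf (v 1)) (nat_of_hf (v 2)))"
    by (intro hf_pred_conj hf_pred_is_Urel hf_pred_is_nat assms(1)) auto
  then obtain \<phi> where \<phi>: "fv \<phi> \<subseteq> {..<3}" "\<And>v. sat HFR v \<phi> \<longleftrightarrow>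
      v 0 \<in> range Urel \<and> v 1 \<in> range hf_nat \<and> v 2 \<in> range hf_nat \<and>
      F (real_of_hf (v 0)) (nat_of_hf (v 1)) = nat_of_hf (v 2)"
    unfolding hf_pred_def assms(2) by blast
  have U: "universe real_exp_struct = UNIV" by (simp add: real_exp_struct_def)
  have "{[Urel x, hf_nat m, hf_nat (F x m)] | x m. x \<in> universe real_exp_struct}
      = {as. length as = 3 \<and> set as \<subseteq> universe HFR \<and> sat HFR (\<lambda>i. as ! i) \<phi>}"
    unfolding \<phi>(2) universe_HFR U by (auto simp: numeral_3_eq_3 length_Suc_conv)
  then show ?thesis
    unfolding HF_definable_fun_def definable_def using \<phi>(1) by blast
qed


section \<open>The two definable functions\<close>

lemma HF_definable_floor_code: "HF_definable_fun real_exp_struct floor_code"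
proof (rule HF_definable_funI)
  show "hf_pred 3 (\<lambda>v. real (nat_of_hf (v 2)) \<le> real (nat_of_hf (v 1)) * exp (real_of_hf (v 0)) \<and>
      real (nat_of_hf (v 1)) * exp (real_of_hf (v 0)) < real (nat_of_hf (v 2)) + 1)"
    by (intro hf_pred_conj hf_pred_le hf_pred_less hf_term_add hf_term_mult hf_term_exp hf_term_1
        hf_term_real_of_hf hf_term_nat_of_hf) auto
qed (auto simp: floor_code_eq_iff)

text \<open>The integer part of \<open>4 ^ j * x\<close> is positive and odd. If all base-4 digits
  of \<open>x\<close> after the point are 0 or 1, this reads off the digit at
  \<open>j\<close>.\<close>

definition odd_digit :: "real \<Rightarrow> nat \<Rightarrow> bool" where
  "odd_digit x j \<longleftrightarrow> (\<exists>z::nat. 2 * real z + 1 \<le> 4 ^ j * x \<and> 4 ^ j * x < 2 * real z + 2)"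

text \<open>A pairing function with values between the squares of \<open>n + k\<close> and of
  \<open>n + k + 1\<close>. Being a polynomial, it is a term over the reals.\<close>

definition position :: "nat \<Rightarrow> nat \<Rightarrow> nat" where
  "position n k = (n + k) * (n + k) + n"

text \<open>The default 0 makes the function total; the reals used in \<open>decode_surj\<close>
  have exactly one odd digit among the positions belonging to each \<open>n\<close>.\<close>

definition decode :: "real \<Rightarrow> nat \<Rightarrow> nat" where
  "decode x n = (if \<exists>k. odd_digit x (position n k) then LEAST k. odd_digit x (position n k) else 0)"

lemma position_inject: "position n k = position n' k' \<longleftrightarrow> n = n' \<and> k = k'"
proof
  have mono: "position n k < position n' k'" if "n + k < n' + k'" for n k n' k'
  proof -
    have "position n k < Suc (n + k) * Suc (n + k)" by (simp add: position_def)
    also have "\<dots> \<le> (n' + k') * (n' + k')" using that by (intro mult_mono) auto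
    also have "\<dots> \<le> position n' k'" by (simp add: position_def)
    finally show ?thesis .
  qed
  assume eq: "position n k = position n' k'"
  then have "n + k = n' + k'"
    using mono[of n k n' k'] mono[of n' k' n k] by linarith
  with eq show "n = n' \<and> k = k'" by (simp add: position_def)
qed simp

text \<open>After scaling by \<open>4 ^ j\<close> the earlier digits contribute an even number, the
  digit at \<open>j\<close> contributes 0 or 1, and the later ones at most 1/3. In base 2 the tail
  could reach 1 and spoil the parity.\<close>

lemma exists_odd_digits: "\<exists>x. \<forall>j. odd_digit x j \<longleftrightarrow> j \<in> A"
proof -
  define a :: "nat \<Rightarrow> real" where "a j = (if j \<in> A then (1 / 4) ^ j else 0)" for j
  have geo: "(\<lambda>i. (1 / 4 :: real) ^ i) sums (4 / 3)"
    using geometric_sums[of "1 / 4 :: real"] by simp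
  have sum_a: "summable a"
    by (rule summable_comparison_test[OF _ sums_summable[OF geo]]) (auto simp: a_def)
  define x where "x = suminf a"
  have "odd_digit x j \<longleftrightarrow> j \<in> A" for j
  proof -
    \<comment> \<open>Half of the earlier contribution: a digit 1 at \<open>i < j\<close>
      contributes \<open>4 ^ (j - i)\<close>, twice the summand given here.\<close>
    define M where "M = (\<Sum>i<j. if i \<in> A then 2 * 4 ^ (j - Suc i) else (0 :: nat))"
    define t where "t = 4 ^ j * suminf (\<lambda>i. a (i + Suc j))"
    have head: "4 ^ j * (\<Sum>i<j. a i) = 2 * real M"
    proof -
      have "4 ^ j * a i = 2 * real (if i \<in> A then 2 * 4 ^ (j - Suc i) else 0)" if "i < j" for i
      proof -
        have "(4 :: real) ^ j = 4 ^ (j - Suc i) * 4 ^ Suc i"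
          using that by (simp flip: power_add del: power_Suc)
        then show ?thesis by (simp add: a_def power_divide)
      qed
      then show ?thesis by (simp add: M_def sum_distrib_left)
    qed
    have split: "x = suminf (\<lambda>i. a (i + Suc j)) + (\<Sum>i<Suc j. a i)"
      unfolding x_def by (rule suminf_split_initial_segment[OF sum_a])
    have eq: "4 ^ j * x = 2 * real M + (if j \<in> A then 1 else 0) + t"
      unfolding split t_def using head
      by (simp add: distrib_left a_def power_divide)
    have tail: "summable (\<lambda>i. a (i + Suc j))"
      by (rule summable_ignore_initial_segment[OF sum_a])
    have "0 \<le> t"
      unfolding t_def using tail by (intro mult_nonneg_nonneg suminf_nonneg) (auto simp: a_def)
    moreover have "t < 1"
    proof -
      have geo': "(\<lambda>i. (1 / 4) ^ Suc j * (1 / 4 :: real) ^ i) sums ((1 / 4) ^ Suc j * (4 / 3))"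
        by (rule sums_mult[OF geo])
      have "suminf (\<lambda>i. a (i + Suc j)) \<le> suminf (\<lambda>i. (1 / 4) ^ Suc j * (1 / 4 :: real) ^ i)"
        by (rule suminf_le[OF _ tail sums_summable[OF geo']]) (auto simp: a_def power_add)
      also have "\<dots> = (1 / 4) ^ Suc j * (4 / 3)" by (rule sums_unique[OF geo', symmetric])
      finally have "t \<le> 4 ^ j * ((1 / 4) ^ Suc j * (4 / 3))"
        unfolding t_def by (intro mult_left_mono) auto
      also have "\<dots> = 1 / 3" by (simp add: power_divide)
      finally show ?thesis by simp
    qed
    ultimately have t: "0 \<le> t" "t < 1" .
    show ?thesis
    proof
      assume "odd_digit x j"
      then obtain z :: nat where z: "2 * real z + 1 \<le> 4 ^ j * x" "4 ^ j * x < 2 * real z + 2"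
        by (auto simp: odd_digit_def)
      show "j \<in> A"
      proof (rule ccontr)
        assume "j \<notin> A"
        then have "real (2 * z) < real (2 * M)" "real (2 * M) < real (2 * z + 2)"
          using z t eq by auto
        then show False unfolding of_nat_less_iff by presburger
      qed
    next
      assume "j \<in> A"
      then show "odd_digit x j"
        unfolding odd_digit_def eq using t by (intro exI[of _ M]) simp
    qed
  qed
  then show ?thesis by blast
qed

lemma decode_surj: "\<exists>x. \<forall>n. decode x n = f n"
proof -
  obtain x where x: "\<And>j. odd_digit x j \<longleftrightarrow> j \<in> range (\<lambda>n. position n (f n))"
    using exists_odd_digits by metis
  then have "odd_digit x (position n k) \<longleftrightarrow> k = f n" for n k
    by (auto simp: position_inject)
  then have "decode x n = f n" for n
    by (simp add: decode_def Least_equality)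
  then show ?thesis by blast
qed

text \<open>A power of 4 with variable exponent is expressed as \<open>exp (j * l)\<close>, where
  \<open>l\<close> is pinned down as the only real with exponential 4. Numerals are sums of
  ones.\<close>

lemma hf_pred_odd_digit:
  assumes x: "hf_term n x" and a: "hf_term n (\<lambda>v. real (a v))" and b: "hf_term n (\<lambda>v. real (b v))"
  shows "hf_pred n (\<lambda>v. odd_digit (x v) (position (a v) (b v)))"
proof -
  let ?e = "\<lambda>v l. exp (((real (a v) + real (b v)) * (real (a v) + real (b v)) + real (a v)) * l) * x v"
  note Suc = hf_term_Suc[OF hf_term_Suc[OF x]] hf_term_Suc[OF hf_term_Suc[OF a]]
    hf_term_Suc[OF hf_term_Suc[OF b]]
  have "hf_pred n (\<lambda>v. \<exists>l. exp l = (1 + 1) + (1 + 1) \<and> (\<exists>z::nat.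
      real z + real z + 1 \<le> ?e v l \<and> ?e v l < real z + real z + (1 + 1)))"
    using hf_term_upd[OF x] hf_term_upd[OF a] hf_term_upd[OF b]
    by (intro hf_pred_ex_real hf_pred_ex_nat hf_pred_conj hf_pred_eq hf_pred_le hf_pred_less
        hf_term_add hf_term_mult hf_term_exp hf_term_1 hf_term_real_of_hf hf_term_nat_of_hf Suc)
      auto
  moreover have "(\<exists>l. exp l = (1 + 1) + (1 + 1) \<and> (\<exists>z::nat.
      real z + real z + 1 \<le> ?e v l \<and> ?e v l < real z + real z + (1 + 1)))
     \<longleftrightarrow> odd_digit (x v) (position (a v) (b v))" for v
  proof -
    have four: "(1 + 1) + (1 + 1) = (4 :: real)" by simp
    have l: "exp l = (1 + 1) + (1 + 1) \<longleftrightarrow> l = ln (4 :: real)" for l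
      unfolding four by (metis exp_ln ln_exp zero_less_numeral)
    have e: "?e v (ln 4) = 4 ^ position (a v) (b v) * x v"
    proof -
      have "((real (a v) + real (b v)) * (real (a v) + real (b v)) + real (a v))
          = real (position (a v) (b v))"
        by (simp add: position_def)
      then show ?thesis by (simp only: exp_of_nat_mult) simp
    qed
    show ?thesis
      by (simp only: l simp_thms e) (simp only: odd_digit_def mult_2 one_add_one)
  qed
  ultimately show ?thesis by simp
qed

lemma HF_definable_decode: "HF_definable_fun real_exp_struct decode"
proof (rule HF_definable_funI)
  show "hf_pred 3 (\<lambda>v.
     odd_digit (real_of_hf (v 0)) (position (nat_of_hf (v 1)) (nat_of_hf (v 2))) \<and>
     \<not> (\<exists>k. real k < real (nat_of_hf (v 2)) \<and>
         odd_digit (real_of_hf (v 0)) (position (nat_of_hf (v 1)) k)) \<or>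
     real (nat_of_hf (v 2)) = 0 \<and>
     \<not> (\<exists>k. odd_digit (real_of_hf (v 0)) (position (nat_of_hf (v 1)) k)))"
    by (intro hf_pred_disj hf_pred_conj hf_pred_not hf_pred_ex_nat hf_pred_odd_digit hf_pred_less
        hf_pred_eq hf_term_0 hf_term_real_of_hf hf_term_nat_of_hf) auto
next
  fix x m k
  let ?P = "\<lambda>k. odd_digit x (position m k)"
  show "?P k \<and> \<not> (\<exists>i. real i < real k \<and> ?P i) \<or> real k = 0 \<and> \<not> (\<exists>i. ?P i) \<longleftrightarrow>
    decode x m = k"
  proof (cases "\<exists>i. ?P i")
    case True
    have "?P k \<and> \<not> (\<exists>i. i < k \<and> ?P i) \<longleftrightarrow> (LEAST i. ?P i) = k"
    proof
      assume "?P k \<and> \<not> (\<exists>i. i < k \<and> ?P i)"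
      then show "(LEAST i. ?P i) = k" by (intro Least_equality) (auto simp: not_less[symmetric])
    next
      assume "(LEAST i. ?P i) = k"
      then show "?P k \<and> \<not> (\<exists>i. i < k \<and> ?P i)"
        using LeastI_ex[OF True] not_less_Least[of _ ?P] by blast
    qed
    then show ?thesis using True by (simp add: decode_def)
  qed (auto simp: decode_def)
qed

lemma weakly_F_selfparameterizable_real_exp: "weakly_F_selfparameterizable real_exp_struct"
  unfolding weakly_F_selfparameterizable_def
proof (rule exI[of _ floor_code], rule conjI, goal_cases)
  case 2
  have "\<forall>f. \<exists>x\<in>universe real_exp_struct. \<forall>n. decode x n = f n"
    using decode_surj by (simp add: real_exp_struct_def)
  then show ?case
    using HF_definable_floor_code HF_definable_decode by blast
qed (rule F_parameterization_floor_code)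


section \<open>Zeros of exponential polynomials\<close>

text \<open>The outer variable is Y and the coefficients are polynomials in X, so
  \<open>pCons\<close> splits off the coefficient free of Y.\<close>

definition bipoly :: "real poly poly \<Rightarrow> real \<Rightarrow> real \<Rightarrow> real" where
  "bipoly P x y = poly (poly P [:y:]) x"

lemma bipoly_simps [simp]:
  "bipoly 0 x y = 0"
  "bipoly (pCons p P) x y = poly p x + y * bipoly P x y"
  "bipoly (P + Q) x y = bipoly P x y + bipoly Q x y"
  "bipoly (P * Q) x y = bipoly P x y * bipoly Q x y"
  by (simp_all add: bipoly_def)

lemma isCont_bipoly: "isCont (\<lambda>y. bipoly P x y) y"
  by (induction P) (auto intro!: continuous_intros)

text \<open>The derivation of \<open>\<real>[X][Y]\<close> that is \<open>d/dX\<close> on \<open>\<real>[X]\<close> and fixes \<open>Y\<close>, as the substitution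
  \<open>Y = e\<^sup>X\<close> requires.\<close>

definition exp_deriv :: "real poly poly \<Rightarrow> real poly poly" where
  "exp_deriv P = map_poly pderiv P + pCons 0 (pderiv P)"

lemma exp_deriv_0 [simp]: "exp_deriv 0 = 0"
  by (simp add: exp_deriv_def)

lemma exp_deriv_pCons: "exp_deriv (pCons p P) = pCons (pderiv p) (P + exp_deriv P)"
proof -
  have "map_poly pderiv (pCons p P) = pCons (pderiv p) (map_poly pderiv P)"
    by (rule poly_eqI) (simp add: coeff_map_poly coeff_pCons split: nat.split)
  then show ?thesis
    by (simp add: exp_deriv_def pderiv_pCons algebra_simps)
qed

lemma coeff_exp_deriv:
  "coeff (exp_deriv P) i = pderiv (coeff P i) + of_nat i * coeff P i"
  by (cases i) (simp_all add: exp_deriv_def coeff_map_poly coeff_pderiv)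

lemma has_real_derivative_bipoly_exp:
  "((\<lambda>x. bipoly P x (exp x)) has_real_derivative bipoly (exp_deriv P) x (exp x)) (at x)"
proof (induction P)
  case 0
  then show ?case by simp
next
  case (pCons p P)
  show ?case
    by (auto simp: exp_deriv_pCons algebra_simps intro!: derivative_eq_intros pCons.IH poly_DERIV)
qed

text \<open>Between two zeros of \<open>f\<close> lies a zero of \<open>f'\<close>, so a zero of
  \<open>f\<close> is determined by the set of zeros of \<open>f'\<close> up to it; there are only
  finitely many such sets.\<close>

lemma finite_zeros_if_finite_zeros_deriv:
  fixes f f' :: "real \<Rightarrow> real"
  assumes deriv: "\<And>x. (f has_real_derivative f' x) (at x)"
    and fin: "finite {x. f' x = 0}"
  shows "finite {x. f x = 0}"
proof -
  let ?s = "\<lambda>x. {z. f' z = 0} \<inter> {..x}"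
  have less: "?s x \<noteq> ?s y" if xy: "x < y" "f x = 0" "f y = 0" for x y
  proof -
    obtain z where "x < z" "z < y" "f y - f x = (y - x) * f' z"
      using MVT2[of x y f f'] xy deriv by blast
    then have "z \<in> ?s y" "z \<notin> ?s x" using xy by auto
    then show ?thesis by metis
  qed
  have "inj_on ?s {x. f x = 0}"
    by (rule linorder_inj_onI) (use less in auto)
  moreover have "?s ` {x. f x = 0} \<subseteq> Pow {z. f' z = 0}" by auto
  ultimately show ?thesis
    using fin by (meson finite_Pow_iff inj_on_finite)
qed

text \<open>By Rolle it suffices to treat the derivative, which lowers the degree of the coefficient of
  \<open>Y\<^sup>0\<close>; once this coefficient vanishes a factor \<open>Y\<close>, which has no zeros, can be removed.\<close>

lemma finite_zeros_bipoly_exp: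
  assumes "P \<noteq> 0"
  shows "finite {x. bipoly P x (exp x) = 0}"
  using assms
proof (induction "degree P" arbitrary: P rule: less_induct)
  case less
  \<comment> \<open>The inner induction is on a bound for the degree of \<open>p\<close>. At
    \<open>k = 0\<close> the polynomial \<open>p\<close> is zero, and the outer hypothesis applies
    to \<open>Q\<close>.\<close>
  have inner: "finite {x. bipoly (pCons p Q) x (exp x) = 0}"
    if "Q \<noteq> 0" "Suc (degree Q) = degree P" "p = 0 \<or> degree p < k" for k p Q
    using that
  proof (induction k arbitrary: p Q)
    case 0
    then have "finite {x. bipoly Q x (exp x) = 0}"
      using less.hyps by simp
    with 0 show ?case by simp
  next
    case (Suc k)
    let ?Q = "Q + exp_deriv Q"
    \<comment> \<open>A coefficient \<open>q\<close> at index \<open>i\<close> turns into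
      \<open>(1 + i) * q\<close> plus the derivative of \<open>q\<close>, whose leading term
      survives. So differentiation preserves the degree in Y.\<close>
    have nz: "coeff ?Q i \<noteq> 0 \<longleftrightarrow> coeff Q i \<noteq> 0" for i
    proof -
      let ?c = "coeff Q i"
      have "coeff (coeff ?Q i) (degree ?c) = (1 + real i) * lead_coeff ?c"
        by (simp add: coeff_exp_deriv coeff_pderiv coeff_eq_0 of_nat_poly algebra_simps)
      moreover have "?c = 0 \<Longrightarrow> coeff ?Q i = 0"
        by (simp add: coeff_exp_deriv)
      ultimately show ?thesis
        by (metis coeff_0 leading_coeff_0_iff mult_eq_0_iff of_nat_Suc of_nat_eq_0_iff nat.distinct(1))
    qed
    have deg: "degree ?Q = degree Q" "?Q \<noteq> 0"
    proof -
      show "degree ?Q = degree Q"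
        by (intro antisym degree_le) (use nz coeff_eq_0 in blast)+
      show "?Q \<noteq> 0"
        using nz Suc.prems(1) by (metis coeff_0 leading_coeff_0_iff)
    qed
    have "pderiv p = 0 \<or> degree (pderiv p) < k"
      using Suc.prems(3) by (cases "degree p") (auto simp: degree_pderiv pderiv_eq_0_iff)
    then have "finite {x. bipoly (exp_deriv (pCons p Q)) x (exp x) = 0}"
      unfolding exp_deriv_pCons using deg Suc.prems by (intro Suc.IH) auto
    then show ?case
      by (rule finite_zeros_if_finite_zeros_deriv[OF has_real_derivative_bipoly_exp])
  qed
  obtain p Q where P: "P = pCons p Q" by (cases P)
  show ?case
  proof (cases "Q = 0")
    case True
    then show ?thesis using less.prems P by (simp add: poly_roots_finite)
  next
    case False
    then show ?thesis
      using inner[of Q p "Suc (degree p)"] P by simp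
  qed
qed

section \<open>Machines near a generic point of the graph\<close>

text \<open>Terms serve to describe the countable ring of polynomials over the constants \<open>c\<close>.\<close>

datatype bterm = Const nat | VarX | VarY | Add bterm bterm | Mult bterm bterm

instance bterm :: countable
  by countable_datatype

primrec bterm_poly :: "(nat \<Rightarrow> real) \<Rightarrow> bterm \<Rightarrow> real poly poly" where
  "bterm_poly c (Const n) = [:[:c n:]:]"
| "bterm_poly c VarX = [:[:0, 1:]:]"
| "bterm_poly c VarY = [:0, 1:]"
| "bterm_poly c (Add s t) = bterm_poly c s + bterm_poly c t"
| "bterm_poly c (Mult s t) = bterm_poly c s * bterm_poly c t"

text \<open>There are countably many terms and each excludes finitely many reals, whereas the reals
  are uncountable.\<close>

lemma exists_exp_generic:
  "\<exists>x. \<forall>t. bterm_poly c t \<noteq> 0 \<longrightarrow> bipoly (bterm_poly c t) x (exp x) \<noteq> 0"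
proof -
  let ?B = "\<Union>t\<in>{t. bterm_poly c t \<noteq> 0}. {x. bipoly (bterm_poly c t) x (exp x) = 0}"
  have "countable ?B"
    by (intro countable_UN) (auto intro: countable_finite finite_zeros_bipoly_exp)
  then have "?B \<noteq> UNIV"
    using uncountable_UNIV_real by metis
  then show ?thesis by blast
qed

section \<open>Germs of rational functions at a generic point\<close>

locale exp_generic =
  fixes c :: "nat \<Rightarrow> real" and x0 :: real
  assumes generic: "bterm_poly c t \<noteq> 0 \<Longrightarrow> bipoly (bterm_poly c t) x0 (exp x0) \<noteq> 0"
    and one_const: "1 \<in> range c"
begin

abbreviation "y0 \<equiv> exp x0"

definition ev :: "bterm \<Rightarrow> real \<Rightarrow> real" where
  "ev t y = bipoly (bterm_poly c t) x0 y"

lemma ev_simps [simp]: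
  "ev (Const n) y = c n" "ev VarX y = x0" "ev VarY y = y"
  "ev (Add s t) y = ev s y + ev t y" "ev (Mult s t) y = ev s y * ev t y"
  by (simp_all add: ev_def)

text \<open>By genericity, vanishing at the point forces the polynomial itself to be zero.\<close>

lemma ev_eq_0: "ev t y0 = 0 \<Longrightarrow> ev t y = 0"
  using generic[of t] by (cases "bterm_poly c t = 0") (auto simp: ev_def)

lemma isCont_ev: "isCont (ev t) y"
  using isCont_bipoly by (simp add: ev_def[abs_def])

lemma ev_nonzero: "ev t y0 \<noteq> 0 \<Longrightarrow> \<forall>\<^sub>F y in nhds y0. ev t y \<noteq> 0"
  using isCont_ev[of y0 t] unfolding isCont_def tendsto_at_iff_tendsto_nhds
  by (rule tendsto_imp_eventually_ne)

text \<open>\<open>nhds y0\<close> includes \<open>y0\<close> itself, so the quotient also gives the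
  value of \<open>g\<close> at \<open>y0\<close>.\<close>

definition germ :: "(real \<Rightarrow> real) \<Rightarrow> bool" where
  "germ g \<longleftrightarrow> (\<exists>s t. ev t y0 \<noteq> 0 \<and> (\<forall>\<^sub>F y in nhds y0. g y = ev s y / ev t y))"

lemma germI: "ev t y0 \<noteq> 0 \<Longrightarrow> \<forall>\<^sub>F y in nhds y0. g y = ev s y / ev t y \<Longrightarrow> germ g"
  by (auto simp: germ_def)

lemma germ_ev: "germ (ev s)"
proof -
  obtain n where "c n = 1" using one_const by (metis imageE)
  then show ?thesis by (intro germI[of "Const n" _ s]) auto
qed

lemma germ_const: "r \<in> range c \<Longrightarrow> germ (\<lambda>_. r)"
  using germ_ev[of "Const n" for n] by (auto simp: ev_simps[abs_def])

lemma germ_x0: "germ (\<lambda>_. x0)" and germ_id: "germ (\<lambda>y. y)"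
  using germ_ev[of VarX] germ_ev[of VarY] by (simp_all add: ev_simps[abs_def])

lemma germ_add: 
  assumes "germ g" "germ h" shows "germ (\<lambda>y. g y + h y)"
proof -
  obtain s t s' t' where *: "ev t y0 \<noteq> 0" "\<forall>\<^sub>F y in nhds y0. g y = ev s y / ev t y"
     "ev t' y0 \<noteq> 0" "\<forall>\<^sub>F y in nhds y0. h y = ev s' y / ev t' y"
    using assms by (auto simp: germ_def)
  show ?thesis
  proof (rule germI)
    show "ev (Mult t t') y0 \<noteq> 0" using * by simp
    show "\<forall>\<^sub>F y in nhds y0. g y + h y = ev (Add (Mult s t') (Mult s' t)) y / ev (Mult t t') y"
      using *(2,4) ev_nonzero[OF *(1)] ev_nonzero[OF *(3)]
      by eventually_elim (simp add: add_frac_eq)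
  qed
qed

lemma germ_mult: 
  assumes "germ g" "germ h" shows "germ (\<lambda>y. g y * h y)"
proof -
  obtain s t s' t' where *: "ev t y0 \<noteq> 0" "\<forall>\<^sub>F y in nhds y0. g y = ev s y / ev t y"
     "ev t' y0 \<noteq> 0" "\<forall>\<^sub>F y in nhds y0. h y = ev s' y / ev t' y"
    using assms by (auto simp: germ_def)
  show ?thesis
  proof (rule germI)
    show "ev (Mult t t') y0 \<noteq> 0" using * by simp
    show "\<forall>\<^sub>F y in nhds y0. g y * h y = ev (Mult s s') y / ev (Mult t t') y"
      using *(2,4) by eventually_elim simp
  qed
qed

lemma germ_divide: 
  assumes "germ g" "germ h" "h y0 \<noteq> 0" shows "germ (\<lambda>y. g y / h y)"
proof -
  obtain s t s' t' where *: "ev t y0 \<noteq> 0" "\<forall>\<^sub>F y in nhds y0. g y = ev s y / ev t y"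
     "ev t' y0 \<noteq> 0" "\<forall>\<^sub>F y in nhds y0. h y = ev s' y / ev t' y"
    using assms by (auto simp: germ_def)
  have "h y0 = ev s' y0 / ev t' y0"
    using *(4) eventually_nhds_x_imp_x by fastforce
  then have "ev s' y0 \<noteq> 0" using assms by auto
  show ?thesis
  proof (rule germI)
    show "ev (Mult t s') y0 \<noteq> 0" using * \<open>ev s' y0 \<noteq> 0\<close> by simp
    show "\<forall>\<^sub>F y in nhds y0. g y / h y = ev (Mult s t') y / ev (Mult t s') y"
      using *(2,4) by eventually_elim simp
  qed
qed

lemma germ_sum: "(\<And>i. i \<in> A \<Longrightarrow> germ (g i)) \<Longrightarrow> 0 \<in> range c \<Longrightarrow> germ (\<lambda>y. \<Sum>i\<in>A. g i y)"
  by (induction A rule: infinite_finite_induct) (auto intro: germ_add germ_const)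

lemma germ_prod: "(\<And>i. i \<in> A \<Longrightarrow> germ (g i)) \<Longrightarrow> germ (\<lambda>y. \<Prod>i\<in>A. g i y)"
  by (induction A rule: infinite_finite_induct) (auto intro: germ_mult germ_const one_const)

lemma germ_power: "germ g \<Longrightarrow> germ (\<lambda>y. g y ^ n)"
  by (induction n) (auto intro: germ_mult germ_const one_const)

lemma germ_zero:
  assumes "germ g" "g y0 = 0" shows "\<forall>\<^sub>F y in nhds y0. g y = 0"
proof -
  obtain s t where *: "ev t y0 \<noteq> 0" "\<forall>\<^sub>F y in nhds y0. g y = ev s y / ev t y"
    using assms by (auto simp: germ_def)
  have "g y0 = ev s y0 / ev t y0"
    using *(2) eventually_nhds_x_imp_x by fastforce
  then have "ev s y0 = 0" using assms * by simp
  then show ?thesis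
    using *(2) ev_eq_0 by simp
qed

lemma germ_tendsto:
  assumes "germ g" shows "(g \<longlongrightarrow> g y0) (nhds y0)"
proof -
  obtain s t where *: "ev t y0 \<noteq> 0" "\<forall>\<^sub>F y in nhds y0. g y = ev s y / ev t y"
    using assms by (auto simp: germ_def)
  have "g y0 = ev s y0 / ev t y0"
    using *(2) eventually_nhds_x_imp_x by fastforce
  moreover have "((\<lambda>y. ev s y / ev t y) \<longlongrightarrow> ev s y0 / ev t y0) (nhds y0)"
    using isCont_ev[of y0 s] isCont_ev[of y0 t] *(1)
    unfolding isCont_def tendsto_at_iff_tendsto_nhds by (intro tendsto_divide)
  ultimately show ?thesis
    using tendsto_cong[OF *(2)] by simp
qed

lemma germ_nonzero: "germ g \<Longrightarrow> g y0 \<noteq> 0 \<Longrightarrow> \<forall>\<^sub>F y in nhds y0. g y \<noteq> 0"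
  by (rule tendsto_imp_eventually_ne[OF germ_tendsto])

lemma germ_neg: "germ g \<Longrightarrow> g y0 < 0 \<Longrightarrow> \<forall>\<^sub>F y in nhds y0. g y < 0"
  by (rule order_tendstoD[OF germ_tendsto])

text \<open>The critical case is value 0 at \<open>y0\<close>, where continuity alone would not fix
  the sign nearby; there the germ vanishes identically.\<close>

lemma germ_nonneg: "germ g \<Longrightarrow> g y0 \<ge> 0 \<Longrightarrow> \<forall>\<^sub>F y in nhds y0. g y \<ge> 0"
  using germ_zero[of g] order_tendstoD(1)[OF germ_tendsto, of g 0]
  by (cases "g y0 = 0") (auto elim: eventually_mono)

end

section \<open>Runs of a machine whose registers are germs\<close>

primrec node_consts :: "bss_node \<Rightarrow> real set" where
  "node_consts (Input L r) = (\<Union>c\<in>ran L. lookup c ` keys c)"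
| "node_consts (Computation g r) = (\<Union>(p, q)\<in>ran g. lookup p ` keys p \<union> lookup q ` keys q)"
| "node_consts (Branch h r r') = lookup h ` keys h"
| "node_consts (Shift_Left r) = {}"
| "node_consts (Shift_Right r) = {}"
| "node_consts (Output L) = (\<Union>c\<in>ran L. lookup c ` keys c)"

lemma countable_node_consts: "wf_node N \<Longrightarrow> countable (node_consts N)"
  by (cases N) (auto intro!: countable_finite finite_ran)

text \<open>The constant -1 lets the test of an output coordinate against 1 be expressed as
  vanishing of a germ.\<close>

locale exp_generic_machine = exp_generic c x0 for c x0 +
  fixes T :: bss_machine
  assumes wf: "wf_machine T"
    and node_consts_range: "a \<in> nodes T \<Longrightarrow> node_consts (label T a) \<subseteq> range c"
    and zero_const: "0 \<in> range c"
    and minus_one_const: "-1 \<in> range c"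
begin

definition germ_state :: "(real \<Rightarrow> int \<Rightarrow>\<^sub>0 real) \<Rightarrow> bool" where
  "germ_state z \<longleftrightarrow> (\<forall>i. germ (\<lambda>y. lookup (z y) i))"

lemma germ_rpoly_eval:
  assumes "lookup p ` keys p \<subseteq> range c" "germ_state z"
  shows "germ (\<lambda>y. rpoly_eval p (z y))"
  unfolding rpoly_eval_def using assms
  by (intro germ_sum germ_mult germ_prod germ_power germ_const zero_const)
    (auto simp: germ_state_def)

lemma germ_lin_eval:
  assumes "lookup l ` keys l \<subseteq> range c" "germ_state z"
  shows "germ (\<lambda>y. lin_eval l (z y))"
  unfolding lin_eval_def using assms
  by (intro germ_sum germ_mult germ_const zero_const) (auto simp: germ_state_def)

lemma germ_state_lin_apply:
  assumes "finite (dom L)" "(\<Union>l\<in>ran L. lookup l ` keys l) \<subseteq> range c" "germ_state z"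
  shows "germ_state (\<lambda>y. lin_apply L (z y))"
  unfolding germ_state_def
proof
  fix i
  have "finite (dom (\<lambda>i. map_option (\<lambda>l. lin_eval l x) (L i)))" for x
    using assms(1) by (simp add: dom_def)
  then have *: "lookup (lin_apply L (z y)) i =
      (case L i of None \<Rightarrow> lookup (z y) i | Some l \<Rightarrow> lin_eval l (z y))" for y
    unfolding lin_apply_def by (subst lookup_override) (auto split: option.split)
  show "germ (\<lambda>y. lookup (lin_apply L (z y)) i)"
    unfolding * using assms
    by (cases "L i") (auto simp: germ_state_def[symmetric] intro!: germ_lin_eval ranI
        dest: germ_state_def[THEN iffD1, rule_format])
qed

lemma germ_state_rat_apply:
  assumes "finite (dom g)"
    and "(\<Union>(p, q)\<in>ran g. lookup p ` keys p \<union> lookup q ` keys q) \<subseteq> range c"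
    and "germ_state z" and def: "rat_defined g (z y0)"
  shows "germ_state (\<lambda>y. rat_apply g (z y))"
  unfolding germ_state_def
proof
  fix i
  have "finite (dom (\<lambda>i. map_option (\<lambda>(p, q). rpoly_eval p x / rpoly_eval q x) (g i)))" for x
    using assms(1) by (simp add: dom_def)
  then have *: "lookup (rat_apply g (z y)) i =
      (case g i of None \<Rightarrow> lookup (z y) i
       | Some pq \<Rightarrow> rpoly_eval (fst pq) (z y) / rpoly_eval (snd pq) (z y))" for y
    unfolding rat_apply_def by (subst lookup_override) (auto split: option.split)
  show "germ (\<lambda>y. lookup (rat_apply g (z y)) i)"
  proof (cases "g i")
    case None
    then show ?thesis unfolding * using assms(3) by (simp add: germ_state_def)
  next
    case (Some pq)
    obtain p q where pq: "pq = (p, q)" by fastforce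
    then have ran: "(p, q) \<in> ran g" using Some by (auto intro: ranI)
    then have "rpoly_eval q (z y0) \<noteq> 0" using def by (auto simp: rat_defined_def)
    moreover have "lookup p ` keys p \<subseteq> range c" "lookup q ` keys q \<subseteq> range c"
      using ran assms(2) by (fastforce)+
    ultimately show ?thesis
      unfolding * Some using pq assms(3) by (auto intro!: germ_divide germ_rpoly_eval)
  qed
qed

text \<open>The sign tested at a branch and the nonvanishing of denominators are conditions on
  germs, so they persist from \<open>y0\<close> to a neighbourhood.\<close>

lemma step_germ:
  assumes step: "bss_step T (a, z y0) (b, w)" and a: "a \<in> nodes T" and z: "germ_state z"
  shows "\<exists>z'. germ_state z' \<and> z' y0 = w \<and> (\<forall>\<^sub>F y in nhds y0. bss_step T (a, z y) (b, z' y))"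
proof -
  have wfn: "wf_node (label T a)" using wf a by (auto simp: wf_machine_def)
  note cs = node_consts_range[OF a]
  from step show ?thesis
  proof cases
    case (computation g)
    have "\<forall>\<^sub>F y in nhds y0. \<forall>(p, q)\<in>ran g. rpoly_eval q (z y) \<noteq> 0"
    proof (rule eventually_ball_finite, safe)
      show "finite (ran g)" using wfn computation by (simp add: finite_ran)
      fix p q assume pq: "(p, q) \<in> ran g"
      have "rpoly_eval q (z y0) \<noteq> 0" using computation pq by (auto simp: rat_defined_def)
      moreover have "lookup q ` keys q \<subseteq> range c"
        using pq cs computation by fastforce
      ultimately show "\<forall>\<^sub>F y in nhds y0. rpoly_eval q (z y) \<noteq> 0"
        using z by (auto intro!: germ_nonzero germ_rpoly_eval)
    qed
    then have "\<forall>\<^sub>F y in nhds y0. bss_step T (a, z y) (b, rat_apply g (z y))"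
    proof eventually_elim
      case (elim y)
      then show ?case
        using bss_step.computation[of T a g b "z y"] computation by (simp add: rat_defined_def)
    qed
    moreover have "germ_state (\<lambda>y. rat_apply g (z y))"
      using computation wfn cs z by (intro germ_state_rat_apply) auto
    ultimately show ?thesis using computation by blast
  next
    case (branch_nonneg h r')
    then have "\<forall>\<^sub>F y in nhds y0. rpoly_eval h (z y) \<ge> 0"
      using cs z by (intro germ_nonneg germ_rpoly_eval) auto
    then have "\<forall>\<^sub>F y in nhds y0. bss_step T (a, z y) (b, z y)"
      using branch_nonneg by (auto elim!: eventually_mono intro!: bss_step.branch_nonneg)
    then show ?thesis using z branch_nonneg by blast
  next
    case (branch_neg h r)
    then have "\<forall>\<^sub>F y in nhds y0. rpoly_eval h (z y) < 0"
      using cs z by (intro germ_neg germ_rpoly_eval) auto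
    then have "\<forall>\<^sub>F y in nhds y0. bss_step T (a, z y) (b, z y)"
      using branch_neg by (auto elim!: eventually_mono intro!: bss_step.branch_neg)
    then show ?thesis using z branch_neg by blast
  next
    case shift_left
    then show ?thesis using z
      by (intro exI[of _ "\<lambda>y. shift_left (z y)"])
        (auto simp: germ_state_def lookup_shift_left intro!: always_eventually bss_step.shift_left)
  next
    case shift_right
    then show ?thesis using z
      by (intro exI[of _ "\<lambda>y. shift_right (z y)"])
        (auto simp: germ_state_def lookup_shift_right intro!: always_eventually bss_step.shift_right)
  qed
qed

lemma bss_step_successor: "bss_step T (a, x) (b, w) \<Longrightarrow> b \<in> successors (label T a)"
  by (erule bss_step.cases) auto

text \<open>A run has finitely many steps, so the neighbourhoods of the single steps can be
  intersected.\<close>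

lemma steps_germ:
  assumes "(bss_step T)\<^sup>*\<^sup>* (a, z y0) (b, w)" "a \<in> nodes T" "germ_state z"
  shows "b \<in> nodes T \<and> (\<exists>z'. germ_state z' \<and> z' y0 = w \<and>
    (\<forall>\<^sub>F y in nhds y0. (bss_step T)\<^sup>*\<^sup>* (a, z y) (b, z' y)))"
  using assms(1)
proof (induction "(b, w)" arbitrary: b w rule: rtranclp_induct)
  case base
  then show ?case using assms by auto
next
  case (step s)
  obtain d u where s: "s = (d, u)" by fastforce
  with step.hyps obtain z' where z': "d \<in> nodes T" "germ_state z'" "z' y0 = u"
    "\<forall>\<^sub>F y in nhds y0. (bss_step T)\<^sup>*\<^sup>* (a, z y) (d, z' y)" by blast
  then obtain z'' where z'': "germ_state z''" "z'' y0 = w"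
    "\<forall>\<^sub>F y in nhds y0. bss_step T (d, z' y) (b, z'' y)"
    using step_germ[of d z' b w] step.hyps s by blast
  have "\<forall>\<^sub>F y in nhds y0. (bss_step T)\<^sup>*\<^sup>* (a, z y) (b, z'' y)"
    using z'(4) z''(3) by eventually_elim (rule rtranclp.rtrancl_into_rtrancl)
  moreover have "b \<in> nodes T"
    using bss_step_successor[of d u b w] step.hyps s z'(1) wf by (auto simp: wf_machine_def)
  ultimately show ?case using z'' by blast
qed

end

section \<open>Outputs and uniqueness of the computed value\<close>

lemma read_seq_eq_one:
  "read_seq x = [1] \<longleftrightarrow> lookup x 0 = 1 \<and> lookup x (-1) \<noteq> 1 \<and> lookup x 1 = 1"
proof
  let ?P = "\<lambda>l. lookup x (- int l) \<noteq> 1"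
  assume R: "read_seq x = [1]"
  then have "length (read_seq x) = 1" by simp
  then have L: "(LEAST l. ?P l) = 1" unfolding read_seq_def by (simp del: upt_Suc)
  \<comment> \<open>Finite support provides a coordinate other than 1; without it the value of
    \<open>LEAST\<close> would be arbitrary.\<close>
  have "\<exists>l. ?P l"
  proof (rule ccontr)
    assume "\<nexists>l. ?P l"
    then have "(\<lambda>l. - int l) ` UNIV \<subseteq> keys x" by (auto simp: in_keys_iff)
    moreover have "infinite ((\<lambda>l. - int l) ` UNIV)"
      by (simp add: finite_image_iff inj_on_def)
    ultimately show False using finite_keys finite_subset by blast
  qed
  then have "?P (LEAST l. ?P l)" by (rule LeastI_ex)
  moreover have "\<not> ?P 0" using L not_less_Least[of 0 ?P] by simp
  ultimately show "lookup x 0 = 1 \<and> lookup x (-1) \<noteq> 1 \<and> lookup x 1 = 1"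
    using L R by (simp add: read_seq_def)
next
  assume *: "lookup x 0 = 1 \<and> lookup x (-1) \<noteq> 1 \<and> lookup x 1 = 1"
  have "(LEAST l. lookup x (- int l) \<noteq> 1) = 1"
  proof (rule Least_equality)
    fix l assume "lookup x (- int l) \<noteq> 1"
    then show "1 \<le> l" using * by (cases l) auto
  qed (use * in simp)
  then show "read_seq x = [1]" using * by (simp add: read_seq_def)
qed

lemma bss_step_deterministic: "bss_step T s t \<Longrightarrow> bss_step T s t' \<Longrightarrow> t = t'"
  by (erule bss_step.cases; erule bss_step.cases) auto

lemma bss_steps_comparable:
  assumes "(bss_step T)\<^sup>*\<^sup>* s t" "(bss_step T)\<^sup>*\<^sup>* s t'"
  shows "(bss_step T)\<^sup>*\<^sup>* t t' \<or> (bss_step T)\<^sup>*\<^sup>* t' t"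
  using assms
proof (induction rule: rtranclp_induct)
  case (step u t)
  then show ?case
    by (metis bss_step_deterministic converse_rtranclpE r_into_rtranclp rtranclp.rtrancl_into_rtrancl)
qed simp

lemma bss_step_Output: "label T b = Output L \<Longrightarrow> (bss_step T)\<^sup>*\<^sup>* (b, z) t \<Longrightarrow> t = (b, z)"
  by (erule converse_rtranclpE) (auto elim: bss_step.cases)

text \<open>The input node is unique, steps are deterministic and output nodes have no successor, so
  both runs end in the same state.\<close>

lemma bss_computes_unique:
  assumes "wf_machine T" "bss_computes T xs ys" "bss_computes T xs ys'"
  shows "ys = ys'"
proof -
  obtain a L r b K z where 1: "a \<in> nodes T" "label T a = Input L r"
    "(bss_step T)\<^sup>*\<^sup>* (r, lin_apply L (embed_seq xs)) (b, z)" "label T b = Output K"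
    "ys = read_seq (lin_apply K z)"
    using assms(2) unfolding bss_computes_def by blast
  obtain a' L' r' b' K' z' where 2: "a' \<in> nodes T" "label T a' = Input L' r'"
    "(bss_step T)\<^sup>*\<^sup>* (r', lin_apply L' (embed_seq xs)) (b', z')" "label T b' = Output K'"
    "ys' = read_seq (lin_apply K' z')"
    using assms(3) unfolding bss_computes_def by blast
  have "a = a'"
    using assms(1) 1(1,2) 2(1,2) by (auto simp: wf_machine_def is_input_def)
  then have "(bss_step T)\<^sup>*\<^sup>* (b, z) (b', z') \<or> (bss_step T)\<^sup>*\<^sup>* (b', z') (b, z)"
    using bss_steps_comparable 1(2,3) 2(2,3) by auto
  then have "(b, z) = (b', z')"
    using bss_step_Output 1(4) 2(4) by metis
  then show ?thesis using 1 2 by simp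
qed

context exp_generic_machine begin

text \<open>The same path leads to the same output node, and the answer depends on three coordinates
  compared with 1, each comparison being stable near \<open>y0\<close>.\<close>

lemma computes_one_near:
  assumes "bss_computes T (xs y0) [1]"
    and xs: "\<And>i. germ (\<lambda>y. lookup (embed_seq (xs y)) i)"
  shows "\<forall>\<^sub>F y in nhds y0. bss_computes T (xs y) [1]"
proof -
  obtain a L r b K z where 1: "a \<in> nodes T" "label T a = Input L r"
    "(bss_step T)\<^sup>*\<^sup>* (r, lin_apply L (embed_seq (xs y0))) (b, z)" "label T b = Output K"
    "[1] = read_seq (lin_apply K z)"
    using assms(1) unfolding bss_computes_def by blast
  have r: "r \<in> nodes T" and wfa: "wf_node (label T a)"
    using wf 1(1,2) by (auto simp: wf_machine_def)
  have "germ_state (\<lambda>y. lin_apply L (embed_seq (xs y)))"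
    using wfa node_consts_range[OF 1(1)] 1(2) xs by (intro germ_state_lin_apply) (auto simp: germ_state_def)
  then obtain z' where b: "b \<in> nodes T" and z': "germ_state z'" "z' y0 = z"
    "\<forall>\<^sub>F y in nhds y0. (bss_step T)\<^sup>*\<^sup>* (r, lin_apply L (embed_seq (xs y))) (b, z' y)"
    using steps_germ[of r "\<lambda>y. lin_apply L (embed_seq (xs y))" b z] 1(3) r by blast
  have wfb: "wf_node (label T b)" using wf b by (auto simp: wf_machine_def)
  define o' where "o' = (\<lambda>y. lin_apply K (z' y))"
  have "germ_state o'"
    unfolding o'_def using wfb node_consts_range[OF b] 1(4) z' by (intro germ_state_lin_apply) auto
  then have g: "germ (\<lambda>y. lookup (o' y) i + - 1)" for i
    by (intro germ_add germ_const minus_one_const) (simp add: germ_state_def)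
  have o': "lookup (o' y0) 0 = 1" "lookup (o' y0) (-1) \<noteq> 1" "lookup (o' y0) 1 = 1"
    using 1(5) read_seq_eq_one[of "o' y0"] z'(2) by (auto simp: o'_def)
  have "\<forall>\<^sub>F y in nhds y0. read_seq (o' y) = [1]"
    using germ_zero[OF g[of 0]] germ_zero[OF g[of 1]] germ_nonzero[OF g[of "-1"]] o'
    by (simp add: read_seq_eq_one eventually_conj_iff)
  with z'(3) show ?thesis
  proof eventually_elim
    case (elim y)
    then show ?case
      unfolding bss_computes_def o'_def using 1 by metis
  qed
qed

end

section \<open>The graph of the exponential function is not decidable by a machine\<close>

lemma not_R_computable_exp_graph: "\<not> R_computable_set {[1, x, 1, exp x] | x. True}"
proof
  let ?S = "{[1, x, 1, exp x] | x :: real. True}"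
  assume "R_computable_set ?S"
  then obtain T where T: "wf_machine T" "\<And>xs. bss_computes T xs (if xs \<in> ?S then [1] else [0])"
    by (auto simp: R_computable_set_def)
  define C where "C = {0, 1, -1} \<union> (\<Union>a\<in>nodes T. node_consts (label T a))"
  have "countable C"
    unfolding C_def
    using T(1) by (intro countable_Un countable_UN countable_node_consts)
      (auto simp: wf_machine_def countable_finite)
  then have "range (from_nat_into C) = C"
    by (intro range_from_nat_into) (auto simp: C_def)
  then obtain c :: "nat \<Rightarrow> real" where c: "range c = C" ..
  obtain x0 where "\<forall>t. bterm_poly c t \<noteq> 0 \<longrightarrow> bipoly (bterm_poly c t) x0 (exp x0) \<noteq> 0"
    using exists_exp_generic by blast
  then interpret exp_generic_machine c x0 T
    by unfold_locales (use T(1) c in \<open>auto simp: C_def\<close>)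
  let ?xs = "\<lambda>y. [1, x0, 1, y]"
  have "\<forall>\<^sub>F y in nhds y0. bss_computes T (?xs y) [1]"
  proof (rule computes_one_near)
    show "bss_computes T (?xs y0) [1]" using T(2)[of "?xs y0"] by auto
    fix i :: int
    \<comment> \<open>Coordinates 2 and 4 hold \<open>x0\<close> and \<open>y\<close>. All others
      are 0 or 1: the length prefixes, the unary length and the padding.\<close>
    consider "i = 2" | "i = 4" | "i \<noteq> 2" "i \<noteq> 4" by blast
    then show "germ (\<lambda>y. lookup (embed_seq (?xs y)) i)"
    proof cases
      case 3
      then have "i = 1 \<or> i = 3 \<or> \<not> (1 \<le> i \<and> i \<le> 4)" by linarith
      then show ?thesis
        using germ_const[OF one_const] germ_const[OF zero_const] by (auto simp: lookup_embed_seq)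
    qed (simp_all add: lookup_embed_seq germ_x0 germ_id)
  qed
  \<comment> \<open>Punctured neighbourhoods of a real are nonempty, so the machine also accepts
    some pair off the graph.\<close>
  then have "\<forall>\<^sub>F y in at y0. y \<noteq> y0 \<and> bss_computes T (?xs y) [1]"
    unfolding eventually_at_filter by (rule eventually_mono) simp
  then obtain y where y: "y \<noteq> y0" "bss_computes T (?xs y) [1]"
    using eventually_happens'[OF at_neq_bot] by blast
  then have "bss_computes T (?xs y) [0]"
    using T(2)[of "?xs y"] by simp
  then show False
    using bss_computes_unique[OF T(1) y(2)] by fastforce
qed

lemma not_R_computable_real_exp: "\<not> R_computable (map_struct (\<lambda>x. [x]) real_exp_struct)"
proof -
  have "tuple_code ` interp (map_struct (\<lambda>x. [x]) real_exp_struct) Exp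
      = {[1, x, 1, exp x] | x. True}"
    by (force simp: map_struct_def real_exp_struct_def tuple_code_def image_iff)
  then show ?thesis
    using not_R_computable_exp_graph by (metis R_computable_def)
qed

theorem theorem3p2:
  "weakly_F_selfparameterizable real_exp_struct \<and>
   \<not> R_computable (map_struct (\<lambda>x. [x]) real_exp_struct)"
  using weakly_F_selfparameterizable_real_exp not_R_computable_real_exp by (rule conjI)

end
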